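(* Consider the dynamical system $\dot x=f(t,x)$ on $\mathbb{R}^n$, where $f:\mathbb{R}_{\ge0}\times\mathbb{R}^n\to\mathbb{R}^n$ is continuous in $(t,x)$. Let $|||\cdot|||=\|\mathcal{P}\cdot\|$ be a semi-norm on $\mathbb{R}^n$. Let $[\![\cdot,\cdot]\!]$ be a compatible weak pairing (on $\operatorname{Ker}|||\cdot|||^\perp$, identified with the image of $\mathcal{P}$) satisfying Deimling's inequality and the curve norm derivative formula. Moreover, assume that there exists $x^*\in\operatorname{Ker}|||\cdot|||^\perp$ such that $f(t,x^*+\operatorname{Ker}|||\cdot|||)\subseteq\operatorname{Ker}|||\cdot|||$ for all $t\ge0$. Then, for $b\in\mathbb{R}$, the following statements are equivalent: (i) $[\![\mathcal{P}f(t,x),\mathcal{P}(x-x^* )]\!]\le b|||x-x^*|||^2$ for all $x\in\mathbb{R}^n$, $t\ge0$; (ii) $D^+|||\phi(t,t_0,x_0)-x^*|||\le b|||\phi(t,t_0,x_0)-x^*|||$ for all $x_0\in\mathbb{R}^n$, $0\le t_0\le t$ for which solutions exist; (iii) $|||\phi(t,t_0,x_0)-x^*|||\le e^{b(t-s)}|||\phi(s,t_0,x_0)-x^*|||$ for all $x_0\in\mathbb{R}^n$, $0\le t_0\le s\le t$ for which solutions exist. Moreover, suppose that $f(t,x)$ is continuously differentiable in $x$ and that $\mu_{|||\cdot|||}(Df(t,x))\le b$ for all $(t,x)$. Then statements (i), (ii), and (iii) hold.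
   Context: Semi-norm convention: $|||v|||=\|\mathcal{P}v\|$ where either $\mathcal{P}\in\mathbb{R}^{m\times n}$ has rank $m\le n$ and $\|\cdot\|$ is a norm on $\mathbb{R}^m$, or $\mathcal{P}\in\mathbb{R}^{n\times n}$ has rank $m\le n$ and $\|\cdot\|$ is a norm on $\mathbb{R}^n$ (with $m\ge1$). $\operatorname{Ker}|||\cdot|||=\{v:|||v|||=0\}=\operatorname{Ker}\mathcal{P}$, and $\operatorname{Ker}|||\cdot|||^\perp$ is its orthogonal complement, on which $|||\cdot|||$ is a norm; $\mathcal{P}$ maps it isomorphically onto the image $V$ of $\mathcal{P}$. Induced semi-norm of $A\in\mathbb{R}^{n\times n}$: $|||A|||=\sup\{|||Av|||/|||v||| : v\in\operatorname{Ker}|||\cdot|||^\perp\setminus\{0_n\}\}$. Log semi-norm: $\mu_{|||\cdot|||}(A)=\lim_{h\to0^+}\frac{|||I_n+hA|||-1}{h}$. A weak pairing on a finite-dimensional real vector space $V$ is a map $[\![\cdot,\cdot]\!]:V\times V\to\mathbb{R}$ such that: (1) $[\![x_1+x_2,y]\!]\le[\![x_1,y]\!]+[\![x_2,y]\!]$, and it is continuous in its first argument; (2) $[\![\alpha x,y]\!]=[\![x,\alpha y]\!]=\alpha[\![x,y]\!]$ for all $\alpha\ge 0$, and $[\![-x,-y]\!]=[\![x,y]\!]$; (3) $[\![x,x]\!]>0$ for $x\ne 0$; (4) $|[\![x,y]\!]|\le[\![x,x]\!]^{1/2}[\![y,y]\!]^{1/2}$. Compatible means $[\![w,w]\!]=\|w\|^2$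 for $w\in V$, i.e. $[\![\mathcal{P}v,\mathcal{P}v]\!]=|||v|||^2$. Deimling's inequality: $[\![x,y]\!]\le\|y\|\lim_{h\to0^+}\frac{\|y+hx\|-\|y\|}{h}$ for all $x,y\in V$. Curve norm derivative formula: for every differentiable $w:\,]a,b[\,\to V$ and almost every $t\in\,]a,b[$, $\|w(t)\|D^+\|w(t)\|=[\![\dot w(t),w(t)]\!]$, where $D^+\varphi(t)=\limsup_{h\to0^+}\frac{\varphi(t+h)-\varphi(t)}{h}$. $\phi(\cdot,t_0,x_0)$ is a (any) solution of $\dot x=f(t,x)$ with $x(t_0)=x_0$. $Df=\partial f/\partial x$. *)

theory Defs
  imports "HOL-Analysis.Analysis"
begin

(* An arbitrary norm on the space, unrelated to the Euclidean type-class norm. *)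
definition is_norm :: "('a::real_vector \<Rightarrow> real) \<Rightarrow> bool" where
  "is_norm N \<longleftrightarrow>
     (\<forall>x. 0 \<le> N x) \<and> (\<forall>x. N x = 0 \<longleftrightarrow> x = 0) \<and>
     (\<forall>c x. N (c *\<^sub>R x) = \<bar>c\<bar> * N x) \<and>
     (\<forall>x y. N (x + y) \<le> N x + N y)"

(* Index types replace dimensions: the first disjunct is an m x n matrix of full row
   rank m = CARD('k), the second an n x n matrix of arbitrary rank m >= 1. *)
definition admissible_matrix :: "real^'n^'k \<Rightarrow> bool" where
  "admissible_matrix P \<longleftrightarrow> 1 \<le> rank P \<and> (rank P = CARD('k) \<or> CARD('k) = CARD('n))"

definition semi_norm :: "(real^'k \<Rightarrow> real) \<Rightarrow> real^'n^'k \<Rightarrow> real^'n \<Rightarrow> real" where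
  "semi_norm N P v = N (P *v v)"

definition semi_ker :: "(real^'k \<Rightarrow> real) \<Rightarrow> real^'n^'k \<Rightarrow> (real^'n) set" where
  "semi_ker N P = {v. semi_norm N P v = 0}"

(* For admissible P the set is nonempty and bounded above, so the real Sup is the supremum. *)
definition induced_semi_norm ::
    "(real^'k \<Rightarrow> real) \<Rightarrow> real^'n^'k \<Rightarrow> real^'n^'n \<Rightarrow> real" where
  "induced_semi_norm N P A =
     Sup {semi_norm N P (A *v v) / semi_norm N P v | v. v \<in> (semi_ker N P)\<^sup>\<bottom> - {0}}"

(* The difference quotient is monotone in h by convexity and bounded, so the limit exists. *)
definition log_semi_norm ::
    "(real^'k \<Rightarrow> real) \<Rightarrow> real^'n^'k \<Rightarrow> real^'n^'n \<Rightarrow> real" where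
  "log_semi_norm N P A =
     Lim (at_right 0) (\<lambda>h. (induced_semi_norm N P (mat 1 + h *\<^sub>R A) - 1) / h)"

definition weak_pairing ::
    "'a::real_normed_vector set \<Rightarrow> ('a \<Rightarrow> 'a \<Rightarrow> real) \<Rightarrow> bool" where
  "weak_pairing V p \<longleftrightarrow> subspace V \<and>
     (\<forall>x1\<in>V. \<forall>x2\<in>V. \<forall>y\<in>V. p (x1 + x2) y \<le> p x1 y + p x2 y) \<and>
     (\<forall>y\<in>V. continuous_on V (\<lambda>x. p x y)) \<and>
     (\<forall>x\<in>V. \<forall>y\<in>V. \<forall>\<alpha>\<ge>0. p (\<alpha> *\<^sub>R x) y = \<alpha> * p x y \<and> p x (\<alpha> *\<^sub>R y) = \<alpha> * p x y) \<and>
     (\<forall>x\<in>V. \<forall>y\<in>V. p (- x) (- y) = p x y) \<and>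
     (\<forall>x\<in>V. x \<noteq> 0 \<longrightarrow> 0 < p x x) \<and>
     (\<forall>x\<in>V. \<forall>y\<in>V. \<bar>p x y\<bar> \<le> sqrt (p x x) * sqrt (p y y))"

definition compatible_pairing ::
    "('a \<Rightarrow> real) \<Rightarrow> 'a set \<Rightarrow> ('a \<Rightarrow> 'a \<Rightarrow> real) \<Rightarrow> bool" where
  "compatible_pairing N V p \<longleftrightarrow> (\<forall>w\<in>V. p w w = (N w)\<^sup>2)"

(* One-sided directional derivatives of a norm always exist, by convexity. *)
definition deimling_inequality ::
    "('a::real_vector \<Rightarrow> real) \<Rightarrow> 'a set \<Rightarrow> ('a \<Rightarrow> 'a \<Rightarrow> real) \<Rightarrow> bool" where
  "deimling_inequality N V p \<longleftrightarrow>
     (\<forall>x\<in>V. \<forall>y\<in>V. p x y \<le> N y * Lim (at_right 0) (\<lambda>h. (N (y + h *\<^sub>R x) - N y) / h))"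

(* Upper right Dini derivative D+; values in ereal because the limsup may be infinite. *)
definition upper_right_dini :: "(real \<Rightarrow> real) \<Rightarrow> real \<Rightarrow> ereal" where
  "upper_right_dini \<phi> t = Limsup (at_right 0) (\<lambda>h. ereal ((\<phi> (t + h) - \<phi> t) / h))"

definition curve_norm_derivative_formula ::
    "('a::real_normed_vector \<Rightarrow> real) \<Rightarrow> 'a set \<Rightarrow> ('a \<Rightarrow> 'a \<Rightarrow> real) \<Rightarrow> bool" where
  "curve_norm_derivative_formula N V p \<longleftrightarrow>
     (\<forall>a b w. (\<forall>t\<in>{a<..<b}. w t \<in> V \<and> w differentiable (at t)) \<longrightarrow>
        (AE t in lebesgue. t \<in> {a<..<b} \<longrightarrow>
           ereal (N (w t)) * upper_right_dini (\<lambda>s. N (w s)) t =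
           ereal (p (vector_derivative w (at t)) (w t))))"

(* J is any interval of nonnegative times containing t0; derivatives are one-sided at
   those endpoints that belong to J. *)
definition ode_solution ::
    "(real \<Rightarrow> 'a::real_normed_vector \<Rightarrow> 'a) \<Rightarrow> real set \<Rightarrow> real \<Rightarrow> 'a \<Rightarrow> (real \<Rightarrow> 'a) \<Rightarrow> bool" where
  "ode_solution f J t0 x0 \<phi> \<longleftrightarrow>
     is_interval J \<and> J \<subseteq> {0..} \<and> t0 \<in> J \<and> \<phi> t0 = x0 \<and>
     (\<forall>t\<in>J. (\<phi> has_vector_derivative f t (\<phi> t)) (at t within J))"

end

theory Submission
  imports Defs "HOL-Complex_Analysis.Great_Picard"
begin

text \<open>
Let \<open>w = P (\<phi> - xs)\<close> for a solution \<open>\<phi>\<close>. The equivalence is proved along the cycle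
\<open>dini_bound\<close> to \<open>pairing_bound\<close> to \<open>exponential_bound\<close> to \<open>dini_bound\<close>, the names given below
to the conditions on the Dini derivative, on the weak pairing, and on the growth of solutions.

Everything rests on the one-sided derivative of a norm, \<open>norm_derivative N y x\<close>. It exists because a
norm is convex, it is sublinear in \<open>x\<close>, and by \<open>upper_right_dini_norm_curve\<close> it is the Dini
derivative of \<open>N\<close> along any curve through \<open>y\<close> with right derivative \<open>x\<close>. Deimling's inequality
bounds the pairing by \<open>N y * norm_derivative N y x\<close>. A bound on the Dini derivative at the initial
time of a solution therefore bounds the pairing at its initial point; that every point is an initial
point is Peano's theorem (\<open>peano_existence\<close>).

Conversely, the curve norm derivative formula turns a bound on the pairing into a differential
inequality for the norm of \<open>exp (- b r) w r\<close>, valid at almost every time. Since this norm is Lipschitz,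
a null set of exceptions does no harm (\<open>lipschitz_nonincreasing_if_AE_dini_nonpos\<close>). Where \<open>w\<close>
vanishes the formula is void, but there the invariance of the kernel makes \<open>w\<close> stationary. The
resulting exponential bound yields the Dini bound by differentiating the exponential.

For a differentiable field, the log semi-norm of the Jacobian bounds the derivative of the norm at
\<open>P z\<close> in the direction \<open>P J z\<close>, for \<open>z\<close> orthogonal to the kernel
(\<open>norm_derivative_le_log_semi_norm\<close>). A mean value inequality for the sublinear function
\<open>norm_derivative N (P z)\<close> transfers this from the Jacobians on a segment to the increment of the
field, and Deimling's inequality turns it into the bound on the pairing.
\<close>

section \<open>Monotonicity from one-sided derivatives\<close>

lemma lipschitz_on_if_vector_derivative_bounded:
  assumes "convex S" "0 \<le> B"
    and deriv: "\<And>x. x \<in> S \<Longrightarrow> (g has_vector_derivative g' x) (at x within S)"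
    and bound: "\<And>x. x \<in> S \<Longrightarrow> norm (g' x) \<le> B"
  shows "B-lipschitz_on S g"
proof (rule lipschitz_onI)
  fix x y assume "x \<in> S" "y \<in> S"
  moreover have "onorm (\<lambda>h. h *\<^sub>R g' z) \<le> B" if "z \<in> S" for z
    by (rule onorm_le) (simp add: mult.commute[of B] mult_left_mono bound[OF that])
  ultimately show "dist (g x) (g y) \<le> B * dist x y"
    using differentiable_bound[OF \<open>convex S\<close>, of g "\<lambda>z h. h *\<^sub>R g' z" B x y] deriv
    by (simp add: has_vector_derivative_def dist_norm)
qed fact

lemma eventually_at_right_0_shift:
  assumes "s < t"
  shows "eventually (\<lambda>h. s + h < t) (at_right (0::real))"
  using assms by (intro eventually_at_rightI[of 0 "t - s"]) auto

text \<open>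
The last point \<open>c\<close> of the closed set where \<open>h r \<le> h s\<close> must be \<open>t\<close>: were \<open>c < t\<close>,
the local hypothesis at \<open>c\<close> would produce a later point of the set.
\<close>

lemma nonincreasing_if_locally_nonincreasing:
  fixes h :: "real \<Rightarrow> real"
  assumes "s \<le> t" and cont: "continuous_on {s..t} h"
    and loc: "\<And>r. s \<le> r \<Longrightarrow> r < t \<Longrightarrow> eventually (\<lambda>k. h (r + k) \<le> h r) (at_right 0)"
  shows "h t \<le> h s"
proof -
  define A where "A = {r \<in> {s..t}. h r \<le> h s}"
  have "A = {s..t} \<inter> h -` {..h s}"
    by (auto simp: A_def)
  then have "closed A"
    using continuous_closed_preimage[OF cont] by simp
  moreover have "s \<in> A" "bdd_above A"
    using \<open>s \<le> t\<close> by (auto simp: A_def)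
  ultimately have A: "closed A" "s \<in> A" "bdd_above A" .
  define c where "c = Sup A"
  have "c \<in> A"
    unfolding c_def using A by (intro closed_contains_Sup) auto
  then have c: "s \<le> c" "c \<le> t" "h c \<le> h s"
    by (auto simp: A_def)
  have "\<not> c < t"
  proof
    assume "c < t"
    have "eventually (\<lambda>k. h (c + k) \<le> h c \<and> c + k < t \<and> 0 < k) (at_right 0)"
      using loc[OF c(1) \<open>c < t\<close>] eventually_at_right_0_shift[OF \<open>c < t\<close>] eventually_at_right_less
      by (intro eventually_conj) auto
    then obtain k where "h (c + k) \<le> h c" "c + k < t" "0 < k"
      using eventually_happens'[of "at_right (0::real)"] by force
    then have "c + k \<in> A"
      using c by (simp add: A_def)
    then show False
      using cSup_upper[OF _ A(3), of "c + k"] \<open>0 < k\<close> by (simp add: c_def)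
  qed
  then show ?thesis
    using c by simp
qed

lemma upper_right_dini_nonpos_D:
  assumes "upper_right_dini h r \<le> 0" "0 < e"
  shows "eventually (\<lambda>k. h (r + k) \<le> h r + e * k) (at_right 0)"
proof -
  have "eventually (\<lambda>k. ereal ((h (r + k) - h r) / k) < ereal e) (at_right 0)"
    using assms unfolding upper_right_dini_def
    by (intro Limsup_lessD) (auto intro: order.strict_trans1)
  with eventually_at_right_less[of "0::real"] show ?thesis
    by eventually_elim (simp add: field_simps)
qed

text \<open>
Subtracting a small multiple of the identity turns slack \<open>e\<close> in the slope into local monotonicity.
\<close>

lemma nonincreasing_if_slack:
  fixes h :: "real \<Rightarrow> real"
  assumes "s \<le> t" and cont: "continuous_on {s..t} h"
    and loc: "\<And>r e. s \<le> r \<Longrightarrow> r < t \<Longrightarrow> 0 < e \<Longrightarrow>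
      eventually (\<lambda>k. h (r + k) \<le> h r + e * k) (at_right 0)"
  shows "h t \<le> h s"
proof (rule field_le_epsilon)
  fix e :: real assume "0 < e"
  define d where "d = e / (1 + t - s)"
  have "0 < d"
    using \<open>0 < e\<close> \<open>s \<le> t\<close> by (simp add: d_def)
  have "h t - d * t \<le> h s - d * s"
  proof (rule nonincreasing_if_locally_nonincreasing[OF \<open>s \<le> t\<close>])
    show "continuous_on {s..t} (\<lambda>r. h r - d * r)"
      by (intro continuous_intros cont)
    fix r assume "s \<le> r" "r < t"
    from loc[OF this \<open>0 < d\<close>]
    show "eventually (\<lambda>k. h (r + k) - d * (r + k) \<le> h r - d * r) (at_right 0)"
      by eventually_elim (simp add: algebra_simps)
  qed
  moreover have "d * (t - s) \<le> e"
    using \<open>0 < e\<close> \<open>s \<le> t\<close> by (simp add: d_def field_simps)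
  ultimately show "h t \<le> h s + e"
    by (simp add: algebra_simps)
qed

text \<open>
The exceptional null set is covered by an open set \<open>U\<close> of small measure, and \<open>L\<close> times the
measure of the part of \<open>U\<close> traversed so far is subtracted from \<open>h\<close>. Inside \<open>U\<close> this
compensation grows with slope \<open>L\<close> and so beats the Lipschitz growth of \<open>h\<close>; outside \<open>U\<close> it
is nondecreasing and the Dini bound applies. In total it costs only \<open>L\<close> times the measure of
\<open>U\<close>.
\<close>

lemma lipschitz_nonincreasing_if_AE_dini_nonpos:
  fixes h :: "real \<Rightarrow> real"
  assumes "s \<le> t" and lip: "L-lipschitz_on {s..t} h"
    and dini: "AE r in lebesgue. r \<in> {s<..<t} \<longrightarrow> upper_right_dini h r \<le> 0"
  shows "h t \<le> h s"
proof (rule field_le_epsilon)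
  fix e :: real assume "0 < e"
  have "0 \<le> L"
    using lip by (rule lipschitz_on_nonneg)
  \<comment> \<open>\<open>d\<close> bounds both the measure of \<open>U\<close> and the slack in the slope; the total error is then
    at most \<open>d * (L + (t - s))\<close>.\<close>
  define d where "d = e / (1 + L + (t - s))"
  have "0 < d"
    using \<open>0 < e\<close> \<open>s \<le> t\<close> \<open>0 \<le> L\<close> by (simp add: d_def)
  obtain E where E: "E \<in> null_sets lebesgue"
    and dini_E: "\<And>r. r \<in> {s<..<t} \<Longrightarrow> r \<notin> E \<Longrightarrow> upper_right_dini h r \<le> 0"
    using dini by (auto elim!: AE_E3)
  \<comment> \<open>The left endpoint joins the null set, since the Dini bound is known only at interior points.\<close>
  have "insert s E \<in> null_sets lebesgue"
    using E negligible_iff_null_sets negligible_insert by blast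
  then obtain U where U: "open U" "insert s E \<subseteq> U" "emeasure lebesgue (U - insert s E) < d"
    using sets_lebesgue_outer_open[OF _ \<open>0 < d\<close>] null_setsD2 by metis
  have "emeasure lebesgue U = emeasure lebesgue (U - insert s E)"
    using \<open>insert s E \<in> null_sets lebesgue\<close> U(1)
    by (intro emeasure_Diff_null_set[symmetric]) auto
  then have emU: "emeasure lebesgue U < d"
    using U(3) by simp
  then have Ufin: "U \<in> lmeasurable"
    using U(1) by (intro fmeasurableI) (auto intro: order.strict_trans)
  have mU: "measure lebesgue U \<le> d"
    using emU \<open>0 < d\<close> by (simp add: emeasure_eq_measure2[OF Ufin] ennreal_less_iff)
  define m where "m r = measure lebesgue (U \<inter> {s..r})" for r
  have meas: "U \<inter> {a..b} \<in> lmeasurable" "U \<inter> {a<..b} \<in> lmeasurable" for a b :: real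
    using Ufin by (auto intro: fmeasurable_Int_fmeasurable)
  have m_step: "m (r + k) = m r + measure lebesgue (U \<inter> {r<..r + k})" if "s \<le> r" "0 \<le> k" for r k
  proof -
    have "U \<inter> {s..r + k} = (U \<inter> {s..r}) \<union> (U \<inter> {r<..r + k})"
      using that by auto
    moreover have disjoint: "(U \<inter> {s..r}) \<inter> (U \<inter> {r<..r + k}) = {}"
      by auto
    ultimately show ?thesis
      unfolding m_def using measure_Un3[OF meas(1) meas(2), of s r r "r + k"]
      by (simp add: disjoint)
  qed
  have step_le: "measure lebesgue (U \<inter> {r<..r + k}) \<le> k" if "0 \<le> k" for r k
  proof -
    have "measure lebesgue (U \<inter> {r<..r + k}) \<le> measure lebesgue {r..r + k}"
      using meas by (intro measure_mono_fmeasurable) auto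
    with that show ?thesis by simp
  qed
  have m_cont: "continuous_on {s..t} m"
  proof (rule lipschitz_on_continuous_on, rule lipschitz_on_leI)
    fix x y assume "x \<in> {s..t}" "y \<in> {s..t}" "x \<le> y"
    then show "dist (m x) (m y) \<le> 1 * dist x y"
      using m_step[of x "y - x"] step_le[of "y - x" x] by (simp add: dist_real_def)
  qed simp
  have "h t - d * t - L * m t \<le> h s - d * s - L * m s"
  proof (rule nonincreasing_if_locally_nonincreasing[OF \<open>s \<le> t\<close>])
    show "continuous_on {s..t} (\<lambda>r. h r - d * r - L * m r)"
      by (intro continuous_intros m_cont lipschitz_on_continuous_on[OF lip])
    fix r assume r: "s \<le> r" "r < t"
    note small = eventually_at_right_0_shift[OF \<open>r < t\<close>] eventually_at_right_less[of "0::real"]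
    show "eventually (\<lambda>k. h (r + k) - d * (r + k) - L * m (r + k) \<le> h r - d * r - L * m r)
            (at_right 0)"
    proof (cases "r \<in> U")
      case True
      then obtain \<delta> where \<delta>: "0 < \<delta>" "ball r \<delta> \<subseteq> U"
        using \<open>open U\<close> open_contains_ball by blast
      have "eventually (\<lambda>k::real. k < \<delta>) (at_right 0)"
        using \<delta> by (intro eventually_at_rightI[of 0 \<delta>]) auto
      with small show ?thesis
      proof eventually_elim
        case (elim k)
        have "U \<inter> {r<..r + k} = {r<..r + k}"
          using \<delta> elim by (auto simp: dist_real_def subset_iff)
        then have "m (r + k) = m r + k"
          using m_step[of r k] r elim by simp
        moreover have "h (r + k) - h r \<le> L * k"
          using lipschitz_onD[OF lip, of "r + k" r] r elim by (simp add: dist_real_def)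
        moreover have "0 < d * k"
          using \<open>0 < d\<close> elim by simp
        ultimately show ?case
          by (simp add: algebra_simps)
      qed
    next
      case False
      then have "r \<noteq> s" "r \<notin> E"
        using U(2) by auto
      then have "upper_right_dini h r \<le> 0"
        using r dini_E[of r] by auto
      from upper_right_dini_nonpos_D[OF this \<open>0 < d\<close>] small show ?thesis
      proof eventually_elim
        case (elim k)
        have "L * m r \<le> L * m (r + k)"
          using \<open>0 \<le> L\<close> r elim by (intro mult_left_mono) (auto simp: m_step)
        with elim show ?case
          by (simp add: algebra_simps)
      qed
    qed
  qed
  moreover have "L * m t \<le> L * d"
    using mU \<open>0 \<le> L\<close> measure_mono_fmeasurable[of "U \<inter> {s..t}" U lebesgue] Ufin meas
    by (intro mult_left_mono) (auto simp: m_def intro: order_trans)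
  moreover have "0 \<le> L * m s"
    using \<open>0 \<le> L\<close> by (simp add: m_def)
  moreover have "d * (L + (t - s)) \<le> e"
    using \<open>0 < e\<close> \<open>s \<le> t\<close> \<open>0 \<le> L\<close> by (simp add: d_def field_simps)
  ultimately show "h t \<le> h s + e"
    by (simp add: algebra_simps)
qed

section \<open>One-sided derivatives of norms\<close>

text \<open>
By convexity the quotient increases with \<open>h\<close>, so as \<open>h\<close> decreases to \<open>0\<close> it tends to its
infimum, which is finite because of the lower bound. Both limits in the problem, the one in
Deimling's inequality and the log semi-norm, exist for this reason.
\<close>

lemma convex_difference_quotient_tendsto:
  fixes c :: "real \<Rightarrow> real"
  assumes convex: "convex_on {0..} c"
    and below: "\<And>h. 0 < h \<Longrightarrow> K \<le> (c h - c 0) / h"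
  obtains L where "((\<lambda>h. (c h - c 0) / h) \<longlongrightarrow> L) (at_right 0)"
proof
  let ?Q = "\<lambda>h. (c h - c 0) / h"
  let ?L = "INF h\<in>{0<..}. ?Q h"
  have bdd: "bdd_below (?Q ` {0<..})"
    using below by (intro bdd_belowI2) auto
  have mono: "?Q h \<le> ?Q k" if "0 < h" "h \<le> k" for h k
  proof (cases "h = k")
    case False
    have flip: "(c 0 - c x) / (0 - x) = ?Q x" for x
      by (metis diff_0 minus_diff_eq minus_divide_divide)
    show ?thesis
      using convex_on_slope_le(1)[OF convex, of 0 k h] that False
      unfolding flip by simp
  qed simp
  show "(?Q \<longlongrightarrow> ?L) (at_right 0)"
  proof (rule order_tendstoI)
    fix a assume "a < ?L"
    have "a < ?Q h" if "0 < h" for h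
      using \<open>a < ?L\<close> cINF_lower[OF bdd, of h] that by simp
    then show "eventually (\<lambda>h. a < ?Q h) (at_right 0)"
      by (intro eventually_at_rightI[of 0 1]) auto
  next
    fix a assume "?L < a"
    then obtain k where k: "0 < k" "?Q k < a"
      using cINF_less_iff[OF _ bdd, of a] by auto
    have "?Q h < a" if "0 < h" "h < k" for h
      using mono[of h k] that k by simp
    then show "eventually (\<lambda>h. ?Q h < a) (at_right 0)"
      using k by (intro eventually_at_rightI[of 0 k]) auto
  qed
qed

text \<open>
The right Gateaux derivative of the norm at \<open>y\<close> in direction \<open>x\<close>, i.e. the limit in Deimling's
inequality.
\<close>

definition norm_derivative :: "('a::real_vector \<Rightarrow> real) \<Rightarrow> 'a \<Rightarrow> 'a \<Rightarrow> real" where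
  "norm_derivative N y x = Lim (at_right 0) (\<lambda>h. (N (y + h *\<^sub>R x) - N y) / h)"

context
  fixes N :: "'a::euclidean_space \<Rightarrow> real"
  assumes norm_N: "is_norm N"
begin

lemma is_norm_nonneg: "0 \<le> N x"
  and is_norm_eq_0_iff: "N x = 0 \<longleftrightarrow> x = 0"
  and is_norm_scaleR: "N (c *\<^sub>R x) = \<bar>c\<bar> * N x"
  and is_norm_triangle: "N (x + y) \<le> N x + N y"
  using norm_N unfolding is_norm_def by blast+

lemma is_norm_0: "N 0 = 0"
  by (simp add: is_norm_eq_0_iff)

lemma is_norm_minus_commute: "N (x - y) = N (y - x)"
  using is_norm_scaleR[of "-1" "x - y"] by simp

lemma is_norm_diff: "\<bar>N x - N y\<bar> \<le> N (x - y)"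
  using is_norm_triangle[of "x - y" y] is_norm_triangle[of "y - x" x]
    is_norm_minus_commute[of x y] by simp

lemma is_norm_upper_bound:
  obtains C where "0 < C" "\<And>x. N x \<le> C * norm x"
proof
  let ?C = "1 + (\<Sum>i\<in>Basis. N i)"
  show "0 < ?C"
    by (intro add_pos_nonneg sum_nonneg is_norm_nonneg) simp
  fix x
  have sum: "N (sum g I) \<le> (\<Sum>i\<in>I. N (g i))" if "finite I" for g :: "'a \<Rightarrow> 'a" and I
    using that
  proof (induction I rule: finite_induct)
    case empty then show ?case by (simp add: is_norm_0)
  next
    case (insert i I) then show ?case using is_norm_triangle[of "g i" "sum g I"] by simp
  qed
  have "N x = N (\<Sum>i\<in>Basis. (x \<bullet> i) *\<^sub>R i)"
    by (simp add: euclidean_representation)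
  also have "\<dots> \<le> (\<Sum>i\<in>Basis. \<bar>x \<bullet> i\<bar> * N i)"
    using sum[OF finite_Basis, of "\<lambda>i. (x \<bullet> i) *\<^sub>R i"] by (simp add: is_norm_scaleR)
  also have "\<dots> \<le> (\<Sum>i\<in>Basis. norm x * N i)"
    by (intro sum_mono mult_right_mono is_norm_nonneg Basis_le_norm)
  also have "\<dots> = norm x * (\<Sum>i\<in>Basis. N i)"
    by (simp only: sum_distrib_left)
  also have "\<dots> \<le> ?C * norm x"
    using norm_ge_zero[of x] by (simp add: distrib_right mult.commute[of "norm x"])
  finally show "N x \<le> ?C * norm x" .
qed

lemma is_norm_lipschitz:
  obtains C where "0 < C" "\<And>x y. \<bar>N x - N y\<bar> \<le> C * norm (x - y)"
proof -
  obtain C where "0 < C" "\<And>x. N x \<le> C * norm x"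
    using is_norm_upper_bound by blast
  then show ?thesis
    by (intro that[of C]) (auto intro: order_trans[OF is_norm_diff])
qed

lemma continuous_on_is_norm: "continuous_on S N"
proof -
  obtain C where "0 < C" "\<And>x y. \<bar>N x - N y\<bar> \<le> C * norm (x - y)"
    using is_norm_lipschitz by blast
  then have "C-lipschitz_on S N"
    by (intro lipschitz_onI) (auto simp: dist_norm)
  then show ?thesis
    by (rule lipschitz_on_continuous_on)
qed

text \<open>
The continuous function \<open>N\<close> attains a positive minimum on the compact Euclidean unit sphere.
\<close>

lemma is_norm_lower_bound:
  obtains c where "0 < c" "\<And>x. c * norm x \<le> N x"
proof -
  have "\<exists>x\<in>sphere 0 1. \<forall>y\<in>sphere (0::'a) 1. N x \<le> N y"
    by (intro continuous_attains_inf continuous_on_is_norm) auto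
  then obtain e :: 'a where e: "norm e = 1" "\<And>y. norm y = 1 \<Longrightarrow> N e \<le> N y"
    by auto
  have "N e * norm x \<le> N x" for x
  proof (cases "x = 0")
    case False
    then have "N e \<le> N ((1 / norm x) *\<^sub>R x)"
      by (intro e) simp
    with False show ?thesis
      by (simp add: is_norm_scaleR field_simps)
  qed (simp add: is_norm_nonneg)
  moreover have "0 < N e"
    using e(1) is_norm_nonneg[of e] is_norm_eq_0_iff[of e] by force
  ultimately show ?thesis
    by (rule that[rotated])
qed

lemma convex_on_is_norm_ray: "convex_on S (\<lambda>h. N (y + h *\<^sub>R x))" if "convex S"
proof (rule convex_onI)
  fix t h k :: real assume t: "0 < t" "t < 1"
  have "y + ((1 - t) *\<^sub>R h + t *\<^sub>R k) *\<^sub>R x = (1 - t) *\<^sub>R (y + h *\<^sub>R x) + t *\<^sub>R (y + k *\<^sub>R x)"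
    by (simp add: algebra_simps)
  then show "N (y + ((1 - t) *\<^sub>R h + t *\<^sub>R k) *\<^sub>R x)
      \<le> (1 - t) * N (y + h *\<^sub>R x) + t * N (y + k *\<^sub>R x)"
    using is_norm_triangle[of "(1 - t) *\<^sub>R (y + h *\<^sub>R x)" "t *\<^sub>R (y + k *\<^sub>R x)"] t
    by (simp add: is_norm_scaleR)
qed (fact that)

lemma norm_derivative_tendsto:
  "((\<lambda>h. (N (y + h *\<^sub>R x) - N y) / h) \<longlongrightarrow> norm_derivative N y x) (at_right 0)"
proof -
  have "- N x \<le> (N (y + h *\<^sub>R x) - N (y + 0 *\<^sub>R x)) / h" if "0 < h" for h
    using is_norm_diff[of "y + h *\<^sub>R x" y] that
    by (simp add: is_norm_scaleR field_simps)
  then obtain L where "((\<lambda>h. (N (y + h *\<^sub>R x) - N (y + 0 *\<^sub>R x)) / h) \<longlongrightarrow> L) (at_right 0)"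
    by (rule convex_difference_quotient_tendsto[OF convex_on_is_norm_ray, rotated]) auto
  then show ?thesis
    unfolding norm_derivative_def by (simp add: tendsto_Lim)
qed

lemma norm_derivative_le: "norm_derivative N y x \<le> N x"
proof (rule tendsto_upperbound[OF norm_derivative_tendsto])
  show "eventually (\<lambda>h. (N (y + h *\<^sub>R x) - N y) / h \<le> N x) (at_right 0)"
  proof (intro eventually_at_rightI[of 0 1])
    fix h :: real assume "h \<in> {0<..<1}"
    then show "(N (y + h *\<^sub>R x) - N y) / h \<le> N x"
      using is_norm_triangle[of y "h *\<^sub>R x"] by (simp add: is_norm_scaleR field_simps)
  qed simp
qed simp

lemma norm_derivative_triangle:
  "norm_derivative N y (x1 + x2) \<le> norm_derivative N y x1 + norm_derivative N y x2"
proof (rule tendsto_le)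
  let ?Q = "\<lambda>x h. (N (y + h *\<^sub>R x) - N y) / h"
  \<comment> \<open>Midpoint convexity compares the quotient at \<open>h\<close> for the sum with those at \<open>2 h\<close>.\<close>
  have dbl: "filterlim (\<lambda>h. 2 * h) (at_right 0) (at_right (0::real))"
    using filtermap_times_pos_at_right[of "2::real" 0] by (simp add: filterlim_def)
  show "((\<lambda>h. ?Q x1 (2 * h) + ?Q x2 (2 * h))
          \<longlongrightarrow> norm_derivative N y x1 + norm_derivative N y x2) (at_right 0)"
    by (intro tendsto_add filterlim_compose[OF norm_derivative_tendsto dbl])
  show "(?Q (x1 + x2) \<longlongrightarrow> norm_derivative N y (x1 + x2)) (at_right 0)"
    by (rule norm_derivative_tendsto)
  have "?Q (x1 + x2) h \<le> ?Q x1 (2 * h) + ?Q x2 (2 * h)" if "0 < h" for h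
  proof -
    have "2 *\<^sub>R (y + h *\<^sub>R (x1 + x2)) = (y + (2 * h) *\<^sub>R x1) + (y + (2 * h) *\<^sub>R x2)"
      by (simp add: algebra_simps scaleR_2)
    then have "2 * N (y + h *\<^sub>R (x1 + x2)) \<le> N (y + (2 * h) *\<^sub>R x1) + N (y + (2 * h) *\<^sub>R x2)"
      using is_norm_scaleR[of 2 "y + h *\<^sub>R (x1 + x2)"] 
        is_norm_triangle[of "y + (2 * h) *\<^sub>R x1" "y + (2 * h) *\<^sub>R x2"] by simp
    then have "(2 * N (y + h *\<^sub>R (x1 + x2)) - 2 * N y) / (2 * h)
        \<le> (N (y + (2 * h) *\<^sub>R x1) + N (y + (2 * h) *\<^sub>R x2) - 2 * N y) / (2 * h)"
      using that by (intro divide_right_mono) auto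
    then show ?thesis
      by (simp add: add_divide_distrib diff_divide_distrib)
  qed
  then show "eventually (\<lambda>h. ?Q (x1 + x2) h \<le> ?Q x1 (2 * h) + ?Q x2 (2 * h)) (at_right 0)"
    by (intro eventually_at_rightI[of 0 1]) auto
qed simp

lemma norm_derivative_scaleR:
  assumes "0 < a"
  shows "norm_derivative N y (a *\<^sub>R x) = a * norm_derivative N y x"
proof (rule tendsto_unique[OF _ norm_derivative_tendsto])
  let ?Q = "\<lambda>h. (N (y + h *\<^sub>R x) - N y) / h"
  have "filterlim (\<lambda>h. a * h) (at_right 0) (at_right (0::real))"
    using filtermap_times_pos_at_right[OF assms, of 0] by (simp add: filterlim_def)
  then have "((\<lambda>h. a * ?Q (a * h)) \<longlongrightarrow> a * norm_derivative N y x) (at_right 0)"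
    by (intro tendsto_intros filterlim_compose[OF norm_derivative_tendsto])
  then show "((\<lambda>h. (N (y + h *\<^sub>R a *\<^sub>R x) - N y) / h) \<longlongrightarrow> a * norm_derivative N y x) (at_right 0)"
    using assms by (simp add: mult.commute)
qed simp

lemma norm_derivative_0: "norm_derivative N y 0 = 0"
  unfolding norm_derivative_def by (auto intro: tendsto_Lim)

lemma norm_derivative_lipschitz:
  "\<bar>norm_derivative N y x1 - norm_derivative N y x2\<bar> \<le> N (x1 - x2)"
  using norm_derivative_triangle[of y "x1 - x2" x2] norm_derivative_triangle[of y "x2 - x1" x1]
    norm_derivative_le[of y "x1 - x2"] norm_derivative_le[of y "x2 - x1"]
    is_norm_minus_commute[of x1 x2] by simp

lemma norm_derivative_minus_self: "norm_derivative N y (- y) = - N y"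
proof (rule tendsto_unique[OF _ norm_derivative_tendsto])
  have "(N (y + h *\<^sub>R (- y)) - N y) / h = - N y" if "0 < h" "h < 1" for h
  proof -
    have "y + h *\<^sub>R (- y) = (1 - h) *\<^sub>R y" by (simp add: algebra_simps)
    then have "N (y + h *\<^sub>R (- y)) = (1 - h) * N y" using that by (simp only: is_norm_scaleR)
    then show ?thesis using that by (simp add: field_simps)
  qed
  then have "eventually (\<lambda>h. (N (y + h *\<^sub>R (- y)) - N y) / h = - N y) (at_right 0)"
    by (intro eventually_at_rightI[of 0 1]) auto
  then show "((\<lambda>h. (N (y + h *\<^sub>R (- y)) - N y) / h) \<longlongrightarrow> - N y) (at_right 0)"
    by (rule tendsto_eventually)
qed simp

lemma tendsto_is_norm: "(g \<longlongrightarrow> l) F \<Longrightarrow> ((\<lambda>x. N (g x)) \<longlongrightarrow> N l) F"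
  using continuous_on_is_norm[of UNIV] by (rule continuous_on_tendsto_compose) auto

end

lemma right_difference_quotient_tendsto:
  fixes w :: "real \<Rightarrow> 'a::real_normed_vector"
  assumes "(w has_vector_derivative d) (at t within S)" "t < u" "{t..u} \<subseteq> S"
  shows "((\<lambda>h. (w (t + h) - w t) /\<^sub>R h) \<longlongrightarrow> d) (at_right 0)"
proof -
  have "(w has_vector_derivative d) (at t within {t..u})"
    using assms by (blast intro: has_vector_derivative_within_subset)
  then have lim: "((\<lambda>y. (1 / norm (y - t)) *\<^sub>R (w y - (w t + (y - t) *\<^sub>R d))) \<longlongrightarrow> 0) (at_right t)"
    using \<open>t < u\<close> by (simp add: has_vector_derivative_def has_derivative_within at_within_Icc_at_right)
  have "((\<lambda>y. (w y - w t) /\<^sub>R (y - t) - d) \<longlongrightarrow> 0) (at_right t)"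
  proof (rule Lim_transform_eventually[OF lim])
    have "(1 / norm (y - t)) *\<^sub>R (w y - (w t + (y - t) *\<^sub>R d)) = (w y - w t) /\<^sub>R (y - t) - d"
      if "t < y" for y
    proof -
      have "(w y - w t) /\<^sub>R (y - t) - d = (w y - w t - (y - t) *\<^sub>R d) /\<^sub>R (y - t)"
        using that by (simp add: scaleR_diff_right)
      with that show ?thesis
        by (simp add: inverse_eq_divide diff_diff_eq)
    qed
    then show "eventually (\<lambda>y. (1 / norm (y - t)) *\<^sub>R (w y - (w t + (y - t) *\<^sub>R d))
        = (w y - w t) /\<^sub>R (y - t) - d) (at_right t)"
      using \<open>t < u\<close> by (intro eventually_at_rightI[of t u]) auto
  qed
  then have "((\<lambda>y. (w y - w t) /\<^sub>R (y - t)) \<longlongrightarrow> d) (at_right t)"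
    by (rule LIM_zero_cancel)
  then show ?thesis
    unfolding filterlim_at_right_to_0[of _ _ t] by (simp add: add.commute)
qed

text \<open>
Replacing the curve by its tangent changes \<open>N\<close> by at most the norm of an error of order
\<open>o(h)\<close>, so the derivative of the norm along the curve is the one along the tangent.
\<close>

lemma is_norm_curve_tendsto:
  fixes w :: "real \<Rightarrow> 'a::euclidean_space"
  assumes N: "is_norm N"
    and w: "(w has_vector_derivative d) (at t within S)" "t < u" "{t..u} \<subseteq> S"
  shows "((\<lambda>h. (N (w (t + h)) - N (w t)) / h) \<longlongrightarrow> norm_derivative N (w t) d) (at_right 0)"
proof -
  let ?q = "\<lambda>h. (w (t + h) - w t) /\<^sub>R h"
  have "((\<lambda>h. N (?q h - d)) \<longlongrightarrow> N (d - d)) (at_right 0)"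
    by (intro tendsto_is_norm[OF N] tendsto_intros right_difference_quotient_tendsto[OF w])
  then have 0: "((\<lambda>h. N (?q h - d)) \<longlongrightarrow> 0) (at_right 0)"
    by (simp add: is_norm_0[OF N])
  have "((\<lambda>h. (N (w (t + h)) - N (w t)) / h - (N (w t + h *\<^sub>R d) - N (w t)) / h) \<longlongrightarrow> 0) (at_right 0)"
  proof (rule Lim_null_comparison[OF _ 0])
    have "norm ((N (w (t + h)) - N (w t)) / h - (N (w t + h *\<^sub>R d) - N (w t)) / h) \<le> N (?q h - d)"
      if "0 < h" for h
    proof -
      have "\<bar>N (w (t + h)) - N (w t + h *\<^sub>R d)\<bar> \<le> N (w (t + h) - (w t + h *\<^sub>R d))"
        by (rule is_norm_diff[OF N])
      also have "w (t + h) - (w t + h *\<^sub>R d) = h *\<^sub>R (?q h - d)"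
        using that by (simp add: algebra_simps)
      also have "N \<dots> = h * N (?q h - d)"
        using that by (simp only: is_norm_scaleR[OF N] abs_of_pos)
      finally show ?thesis
        using that by (simp add: diff_divide_distrib[symmetric] field_simps)
    qed
    then show "eventually (\<lambda>h. norm ((N (w (t + h)) - N (w t)) / h - (N (w t + h *\<^sub>R d) - N (w t)) / h)
        \<le> N (?q h - d)) (at_right 0)"
      by (intro eventually_at_rightI[of 0 1]) auto
  qed
  from tendsto_add[OF this norm_derivative_tendsto[OF N, of "w t" d]] show ?thesis
    by simp
qed

text \<open>
Along a right-differentiable curve the Dini derivative of the norm is thus a finite number to which
Deimling's inequality applies.
\<close>

lemma upper_right_dini_norm_curve:
  fixes w :: "real \<Rightarrow> 'a::euclidean_space"
  assumes "is_norm N" "(w has_vector_derivative d) (at t within S)" "t < u" "{t..u} \<subseteq> S"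
  shows "upper_right_dini (\<lambda>s. N (w s)) t = ereal (norm_derivative N (w t) d)"
  unfolding upper_right_dini_def
  by (intro lim_imp_Limsup tendsto_ereal is_norm_curve_tendsto[OF assms]) simp

section \<open>Existence of solutions\<close>

locale bounded_vector_field =
  fixes F :: "real \<Rightarrow> 'a::euclidean_space \<Rightarrow> 'a"
    and a b M :: real and x0 :: 'a
  assumes le: "a \<le> b"
    and cont: "continuous_on ({a..b} \<times> UNIV) (\<lambda>(t, x). F t x)"
    and bound: "\<And>t x. t \<in> {a..b} \<Longrightarrow> norm (F t x) \<le> M"
begin

lemma M_nonneg: "0 \<le> M"
  using bound[of a x0] le norm_ge_zero order_trans by (metis atLeastAtMost_iff order_refl)

lemma continuous_field_along:
  assumes "continuous_on {a..b} u"
  shows "continuous_on {a..b} (\<lambda>s. F s (u s))"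
  using continuous_on_compose2[OF cont, of "{a..b}" "\<lambda>s. (s, u s)"] assms
  by (force intro!: continuous_intros)

text \<open>
Tonelli's device: the Picard operator is fed values from time \<open>1 / Suc n\<close> earlier, so a fixed
point is determined step by step, whether or not the field is Lipschitz.
\<close>

definition delay :: "nat \<Rightarrow> real \<Rightarrow> real" where
  "delay n s = max a (s - 1 / Suc n)"

definition delayed_picard :: "nat \<Rightarrow> (real \<Rightarrow> 'a) \<Rightarrow> real \<Rightarrow> 'a" where
  "delayed_picard n u t = x0 + integral {a..t} (\<lambda>s. F s (u (delay n s)))"

lemma delay_in: "s \<in> {a..b} \<Longrightarrow> delay n s \<in> {a..b}"
  by (auto simp: delay_def intro: order_trans[of _ s])

lemma delay_close: "s \<in> {a..b} \<Longrightarrow> \<bar>delay n s - s\<bar> \<le> 1 / Suc n"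
  by (auto simp: delay_def max_def abs_if)

lemma continuous_delayed_field:
  assumes "continuous_on {a..b} u"
  shows "continuous_on {a..b} (\<lambda>s. F s (u (delay n s)))"
proof (rule continuous_field_along)
  have "continuous_on {a..b} (delay n)"
    unfolding delay_def by (intro continuous_intros)
  then show "continuous_on {a..b} (\<lambda>s. u (delay n s))"
    by (rule continuous_on_compose2[OF assms]) (use delay_in in blast)
qed

lemma delayed_picard_lipschitz:
  assumes u: "continuous_on {a..b} u"
  shows "M-lipschitz_on {a..b} (delayed_picard n u)"
proof (rule lipschitz_on_leI)
  fix t t' assume t: "t \<in> {a..b}" "t' \<in> {a..b}" "t \<le> t'"
  let ?g = "\<lambda>s. F s (u (delay n s))"
  have g: "continuous_on {t..t'} ?g" "continuous_on {a..t'} ?g"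
    using t by (auto intro: continuous_on_subset[OF continuous_delayed_field[OF u]])
  have "integral {a..t} ?g + integral {t..t'} ?g = integral {a..t'} ?g"
    using t by (intro Henstock_Kurzweil_Integration.integral_combine integrable_continuous_real g) auto
  then have "delayed_picard n u t' - delayed_picard n u t = integral {t..t'} ?g"
    by (simp add: delayed_picard_def algebra_simps)
  moreover have "norm (integral {t..t'} ?g) \<le> M * (t' - t)"
    using t by (intro integral_bound g bound) auto
  ultimately show "dist (delayed_picard n u t) (delayed_picard n u t') \<le> M * dist t t'"
    using t by (simp add: dist_norm norm_minus_commute)
qed (rule M_nonneg)

abbreviation iterate :: "nat \<Rightarrow> nat \<Rightarrow> real \<Rightarrow> 'a" where
  "iterate n k \<equiv> (delayed_picard n ^^ k) (\<lambda>_. x0)"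

lemma continuous_iterate: "continuous_on {a..b} (iterate n k)"
  by (induction k) (auto intro: lipschitz_on_continuous_on delayed_picard_lipschitz)

text \<open>
Each application of the operator fixes the iterates on one more interval of length \<open>1 / Suc n\<close>.
\<close>

lemma iterate_stable:
  "t \<in> {a..b} \<Longrightarrow> t \<le> a + k / Suc n \<Longrightarrow> iterate n (Suc k) t = iterate n k t"
proof (induction k arbitrary: t)
  case 0
  then have "t = a" by simp
  then show ?case by (simp add: delayed_picard_def)
next
  case (Suc k)
  have "iterate n (Suc k) (delay n s) = iterate n k (delay n s)" if "s \<in> {a..t}" for s
  proof (rule Suc.IH)
    show "delay n s \<in> {a..b}"
      using that Suc.prems by (intro delay_in) auto
    have "s \<le> a + (real k + 1) / Suc n"
      using that Suc.prems(2) by (simp add: add.commute)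
    then show "delay n s \<le> a + k / Suc n"
      by (simp add: delay_def add_divide_distrib)
  qed
  then have "delayed_picard n (iterate n (Suc k)) t = delayed_picard n (iterate n k) t"
    unfolding delayed_picard_def by (intro arg_cong2[of _ _ _ _ "(+)"] integral_cong) auto
  then show ?case by simp
qed

lemma tonelli_approximation:
  obtains y where "continuous_on {a..b} y" "\<And>t. t \<in> {a..b} \<Longrightarrow> delayed_picard n y t = y t"
proof -
  \<comment> \<open>After \<open>k\<close> applications the stable part covers \<open>[a, b]\<close>.\<close>
  obtain k :: nat where "(b - a) * Suc n \<le> k"
    using real_arch_simple by blast
  then have "b \<le> a + k / Suc n"
    by (simp add: field_simps)
  then show ?thesis
    using iterate_stable[of _ k n] continuous_iterate[of k n] by (intro that[of "iterate n k"]) auto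
qed

text \<open>
The fixed points of the delayed operators share the Lipschitz constant \<open>M\<close>, so by
Arzela--Ascoli a subsequence converges uniformly. As the delay vanishes, dominated convergence
carries the integral equation over to the limit.
\<close>

lemma peano_bounded:
  obtains g where "g a = x0"
    "\<And>t. t \<in> {a..b} \<Longrightarrow> (g has_vector_derivative F t (g t)) (at t within {a..b})"
proof -
  have "\<exists>y. \<forall>n. continuous_on {a..b} (y n) \<and> (\<forall>t\<in>{a..b}. delayed_picard n (y n) t = y n t)"
    by (rule choice) (metis tonelli_approximation)
  then obtain y where y_cont: "\<And>n. continuous_on {a..b} (y n)"
    and y_fix: "\<And>n t. t \<in> {a..b} \<Longrightarrow> delayed_picard n (y n) t = y n t"
    by metis
  have y_lip: "norm (y n t - y n t') \<le> M * \<bar>t - t'\<bar>" if "t \<in> {a..b}" "t' \<in> {a..b}" for n t t'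
    using lipschitz_onD[OF delayed_picard_lipschitz[OF y_cont], of t t' n n] that
    by (simp add: y_fix dist_norm)
  have y_a: "y n a = x0" for n
    using y_fix[of a n] le by (simp add: delayed_picard_def)
  obtain g k where g_cont: "continuous_on {a..b} g" and k: "strict_mono (k :: nat \<Rightarrow> nat)"
    and g: "\<And>e. 0 < e \<Longrightarrow> \<exists>N. \<forall>n x. n \<ge> N \<and> x \<in> {a..b} \<longrightarrow> norm (y (k n) x - g x) < e"
  proof (rule Arzela_Ascoli[of "{a..b}" y "norm x0 + M * (b - a)"])
    fix n t assume t: "t \<in> {a..b}"
    then have "norm (y n t - x0) \<le> M * (b - a)"
      using y_lip[of t a n] M_nonneg mult_left_mono[of "t - a" "b - a" M] by (auto simp: y_a)
    then show "norm (y n t) \<le> norm x0 + M * (b - a)"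
      using norm_triangle_ineq2[of "y n t" x0] by simp
  next
    fix t e :: real assume t: "t \<in> {a..b}" "0 < e"
    have "norm (y n t - y n t') < e" if "t' \<in> {a..b}" "norm (t - t') < e / (M + 1)" for n t'
    proof -
      have "norm (y n t - y n t') \<le> M * \<bar>t - t'\<bar>"
        using y_lip t that by blast
      also have "\<dots> \<le> (M + 1) * \<bar>t - t'\<bar>"
        by (intro mult_right_mono) auto
      also have "\<dots> < e"
        using that M_nonneg by (simp add: field_simps)
      finally show ?thesis .
    qed
    then show "\<exists>d>0. \<forall>n t'. t' \<in> {a..b} \<and> norm (t - t') < d \<longrightarrow> norm (y n t - y n t') < e"
      using t M_nonneg by (intro exI[of _ "e / (M + 1)"]) auto
  qed auto
  have lim: "(\<lambda>n. y (k n) t) \<longlonglongrightarrow> g t" if "t \<in> {a..b}" for t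
    unfolding LIMSEQ_iff using g that by meson
  have lim_delay: "(\<lambda>n. y (k n) (delay (k n) s)) \<longlonglongrightarrow> g s" if s: "s \<in> {a..b}" for s
  proof -
    have "(\<lambda>n. y (k n) (delay (k n) s) - y (k n) s) \<longlonglongrightarrow> 0"
    proof (rule Lim_null_comparison)
      have "norm (y m (delay m s) - y m s) \<le> M * (1 / Suc m)" for m
        using y_lip[OF delay_in[OF s] s, of m m] mult_left_mono[OF delay_close[OF s] M_nonneg, of m]
        by linarith
      then show "eventually (\<lambda>n. norm (y (k n) (delay (k n) s) - y (k n) s) \<le> M * (1 / Suc (k n)))
          sequentially"
        by simp
      show "(\<lambda>n. M * (1 / Suc (k n))) \<longlonglongrightarrow> 0"
        using tendsto_mult_right_zero[OF LIMSEQ_subseq_LIMSEQ[OF LIMSEQ_inverse_real_of_nat k], of M]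
        by (simp add: o_def inverse_eq_divide)
    qed
    from tendsto_add[OF this lim[OF s]] show ?thesis by simp
  qed
  have g_eq: "g t = x0 + integral {a..t} (\<lambda>s. F s (g s))" if t: "t \<in> {a..b}" for t
  proof (rule LIMSEQ_unique[OF lim[OF t]])
    have "(\<lambda>n. integral {a..t} (\<lambda>s. F s (y (k n) (delay (k n) s))))
        \<longlonglongrightarrow> integral {a..t} (\<lambda>s. F s (g s))"
    proof (rule dominated_convergence(2)[where h = "\<lambda>_. M"])
      show "(\<lambda>s. F s (y (k n) (delay (k n) s))) integrable_on {a..t}" for n
        using t by (intro integrable_continuous_real continuous_on_subset[OF continuous_delayed_field[OF y_cont]]) auto
      fix s assume "s \<in> {a..t}"
      then have s: "s \<in> {a..b}" using t by auto
      then show "norm (F s (y (k n) (delay (k n) s))) \<le> M" for n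
        by (rule bound)
      have "continuous_on UNIV (F s)"
        using continuous_on_compose2[OF cont, of UNIV "\<lambda>x. (s, x)"] s
        by (force intro!: continuous_intros)
      then show "(\<lambda>n. F s (y (k n) (delay (k n) s))) \<longlonglongrightarrow> F s (g s)"
        by (rule continuous_on_tendsto_compose[OF _ lim_delay[OF s]]) auto
    qed auto
    then have "(\<lambda>n. delayed_picard (k n) (y (k n)) t) \<longlonglongrightarrow> x0 + integral {a..t} (\<lambda>s. F s (g s))"
      unfolding delayed_picard_def by (intro tendsto_intros)
    then show "(\<lambda>n. y (k n) t) \<longlonglongrightarrow> x0 + integral {a..t} (\<lambda>s. F s (g s))"
      by (simp add: y_fix[OF t])
  qed
  show ?thesis
  proof (rule that)
    show "g a = x0" using g_eq[of a] le by simp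
    fix t assume t: "t \<in> {a..b}"
    have "((\<lambda>u. x0 + integral {a..u} (\<lambda>s. F s (g s))) has_vector_derivative 0 + F t (g t))
        (at t within {a..b})"
      by (intro has_vector_derivative_add has_vector_derivative_const t
          integral_has_vector_derivative continuous_field_along g_cont)
    then show "(g has_vector_derivative F t (g t)) (at t within {a..b})"
      using t by (subst has_vector_derivative_cong_ev[where g = "\<lambda>u. x0 + integral {a..u} (\<lambda>s. F s (g s))"])
        (auto simp: g_eq[symmetric] intro!: always_eventually)
  qed
qed

end

text \<open>
Composition with the metric projection onto a ball makes the field bounded without changing it on
the ball, and for a time of order \<open>1 / M\<close> the solution of the modified equation does not leave
the ball.
\<close>

theorem peano_existence:
  fixes f :: "real \<Rightarrow> 'a::euclidean_space \<Rightarrow> 'a"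
  assumes cont: "continuous_on ({t0..t0 + 1} \<times> UNIV) (\<lambda>(t, x). f t x)"
  obtains d g where "0 < d" "g t0 = x0"
    "\<And>t. t \<in> {t0..t0 + d} \<Longrightarrow> (g has_vector_derivative f t (g t)) (at t within {t0..t0 + d})"
proof -
  let ?B = "cball x0 1"
  define F where "F t x = f t (closest_point ?B x)" for t x
  have proj: "closest_point ?B x \<in> ?B" for x
    by (rule closest_point_in_set) auto
  have F_cont: "continuous_on ({t0..t0 + 1} \<times> UNIV) (\<lambda>(t, x). F t x)"
  proof -
    have "continuous_on ({t0..t0 + 1} \<times> UNIV) (\<lambda>z. (fst z, closest_point ?B (snd z)))"
      by (intro continuous_on_Pair continuous_on_fst continuous_on_id
          continuous_on_compose2[OF continuous_on_closest_point continuous_on_snd]) auto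
    from continuous_on_compose2[OF cont this] show ?thesis
      by (simp add: F_def case_prod_unfold image_subset_iff)
  qed
  have "compact ((\<lambda>(t, x). f t x) ` ({t0..t0 + 1} \<times> ?B))"
    by (intro compact_continuous_image compact_Times continuous_on_subset[OF cont]) auto
  then obtain M where M: "\<And>t x. t \<in> {t0..t0 + 1} \<Longrightarrow> x \<in> ?B \<Longrightarrow> norm (f t x) \<le> M"
    by (force simp: bounded_iff dest!: compact_imp_bounded)
  have F_bound: "norm (F t x) \<le> M" if "t \<in> {t0..t0 + 1}" for t x
    unfolding F_def using M[OF that proj] .
  have "0 \<le> M"
    using order_trans[OF norm_ge_zero F_bound[of t0 x0]] by simp
  define d where "d = 1 / (1 + M)"
  have d: "0 < d" "d \<le> 1" "M * d \<le> 1"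
    using \<open>0 \<le> M\<close> by (auto simp: d_def field_simps)
  interpret bounded_vector_field F t0 "t0 + d" M x0
    using d F_bound by unfold_locales (auto intro: continuous_on_subset[OF F_cont])
  obtain g where g0: "g t0 = x0"
    and g: "\<And>t. t \<in> {t0..t0 + d} \<Longrightarrow> (g has_vector_derivative F t (g t)) (at t within {t0..t0 + d})"
    using peano_bounded by blast
  have "F t (g t) = f t (g t)" if t: "t \<in> {t0..t0 + d}" for t
  proof -
    have "M-lipschitz_on {t0..t0 + d} g"
      by (rule lipschitz_on_if_vector_derivative_bounded[OF _ \<open>0 \<le> M\<close> g bound]) auto
    then have "dist (g t) (g t0) \<le> M * dist t t0"
      using t d by (intro lipschitz_onD) auto
    also have "\<dots> \<le> M * d"
      using t \<open>0 \<le> M\<close> by (intro mult_left_mono) (auto simp: dist_real_def)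
    finally have "g t \<in> ?B"
      using d g0 by (simp add: dist_commute)
    then show ?thesis
      by (simp add: F_def closest_point_self)
  qed
  with g d g0 show ?thesis
    by (intro that[of d g]) auto
qed

section \<open>Log semi-norms\<close>

text \<open>
Jensen's inequality for the sublinear function \<open>norm_derivative N y\<close> and the mean of \<open>G'\<close> would
give this when \<open>G'\<close> is integrable. The proof does without the integral: by subadditivity
\<open>norm_derivative N y (G r - G 0)\<close> grows at \<open>r\<close> with slope at most
\<open>norm_derivative N y (G' r)\<close>.
\<close>

lemma norm_derivative_mean_value:
  fixes G :: "real \<Rightarrow> 'a::euclidean_space"
  assumes N: "is_norm N"
    and G: "\<And>r. r \<in> {0..1} \<Longrightarrow> (G has_vector_derivative G' r) (at r within {0..1})"
    and le: "\<And>r. r \<in> {0..1} \<Longrightarrow> norm_derivative N y (G' r) \<le> c"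
  shows "norm_derivative N y (G 1 - G 0) \<le> c"
proof -
  let ?q = "norm_derivative N y"
  obtain C where C: "0 < C" "\<And>x. N x \<le> C * norm x"
    using is_norm_upper_bound[OF N] by blast
  have "C-lipschitz_on UNIV ?q"
    using C(1) order_trans[OF norm_derivative_lipschitz[OF N] C(2)]
    by (intro lipschitz_onI) (auto simp: dist_norm)
  then have q_cont: "continuous_on UNIV ?q"
    by (rule lipschitz_on_continuous_on)
  have G_cont: "continuous_on {0..1} G"
    using G by (rule continuous_on_vector_derivative)
  have "?q (G 1 - G 0) - c * 1 \<le> ?q (G 0 - G 0) - c * 0"
  proof (rule nonincreasing_if_slack[where h = "\<lambda>r. ?q (G r - G 0) - c * r"])
    show "continuous_on {0..1} (\<lambda>r. ?q (G r - G 0) - c * r)"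
      by (intro continuous_intros continuous_on_compose2[OF q_cont] G_cont) auto
    fix r e :: real assume r: "0 \<le> r" "r < 1" and "0 < e"
    have "((\<lambda>k. ?q ((G (r + k) - G r) /\<^sub>R k)) \<longlongrightarrow> ?q (G' r)) (at_right 0)"
      using r by (intro continuous_on_tendsto_compose[OF q_cont]
          right_difference_quotient_tendsto[OF G, of r 1]) auto
    moreover have "?q (G' r) < c + e"
      using le[of r] r \<open>0 < e\<close> by simp
    ultimately have "eventually (\<lambda>k. ?q ((G (r + k) - G r) /\<^sub>R k) < c + e) (at_right 0)"
      by (rule order_tendstoD)
    then show "eventually (\<lambda>k. ?q (G (r + k) - G 0) - c * (r + k)
        \<le> ?q (G r - G 0) - c * r + e * k) (at_right 0)"
      using eventually_at_right_less[of "0::real"]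
    proof eventually_elim
      case (elim k)
      have "?q (G (r + k) - G r) = ?q (k *\<^sub>R ((G (r + k) - G r) /\<^sub>R k))"
        using elim by simp
      also have "\<dots> = k * ?q ((G (r + k) - G r) /\<^sub>R k)"
        using elim by (intro norm_derivative_scaleR[OF N])
      also have "\<dots> \<le> k * (c + e)"
        using elim by (intro mult_left_mono) auto
      finally show ?case
        using norm_derivative_triangle[OF N, of y "G (r + k) - G r" "G r - G 0"]
        by (simp add: algebra_simps)
    qed
  qed simp
  then show ?thesis
    by (simp add: norm_derivative_0[OF N])
qed

lemma semi_ker_eq: "is_norm N \<Longrightarrow> semi_ker N P = {v. P *v v = 0}"
  by (simp add: semi_ker_def semi_norm_def is_norm_eq_0_iff)

lemma subspace_semi_ker: "is_norm N \<Longrightarrow> subspace (semi_ker N P)"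
  by (auto simp: semi_ker_eq subspace_def matrix_vector_right_distrib matrix_vector_mult_scaleR)

context
  fixes N :: "real^'k \<Rightarrow> real" and P :: "real^'n^'k"
  assumes norm_N: "is_norm N"
begin

lemma semi_norm_pos_on_complement:
  assumes "v \<in> (semi_ker N P)\<^sup>\<bottom>" "v \<noteq> 0"
  shows "0 < semi_norm N P v"
proof -
  have "v \<notin> semi_ker N P"
    using assms by (auto simp: orthogonal_comp_def orthogonal_self)
  then show ?thesis
    using is_norm_nonneg[OF norm_N, of "P *v v"] by (simp add: semi_ker_def semi_norm_def)
qed

text \<open>
On the orthogonal complement of its kernel \<open>P\<close> is injective and hence bounded below, so there
the semi-norm dominates a multiple of the Euclidean norm.
\<close>

lemma bdd_above_semi_norm_ratios:
  "bdd_above {semi_norm N P (A *v v) / semi_norm N P v | v. v \<in> (semi_ker N P)\<^sup>\<bottom> - {0}}"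
proof -
  obtain C where C: "0 < C" "\<And>x. N x \<le> C * norm x"
    using is_norm_upper_bound[OF norm_N] by blast
  obtain c where c: "0 < c" "\<And>x. c * norm x \<le> N x"
    using is_norm_lower_bound[OF norm_N] by blast
  have "\<exists>e>0. \<forall>v\<in>(semi_ker N P)\<^sup>\<bottom>. norm (P *v v) \<ge> e * norm v"
  proof (rule injective_imp_isometric)
    show "closed ((semi_ker N P)\<^sup>\<bottom>)" "subspace ((semi_ker N P)\<^sup>\<bottom>)"
      by (auto intro: closed_subspace subspace_orthogonal_comp)
    show "\<forall>v\<in>(semi_ker N P)\<^sup>\<bottom>. P *v v = 0 \<longrightarrow> v = 0"
      using semi_norm_pos_on_complement is_norm_0[OF norm_N] by (force simp: semi_norm_def)
  qed simp
  then obtain e where e: "0 < e" "\<And>v. v \<in> (semi_ker N P)\<^sup>\<bottom> \<Longrightarrow> e * norm v \<le> norm (P *v v)"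
    by blast
  obtain K where K: "0 \<le> K" "\<And>v. norm (P *v (A *v v)) \<le> K * norm v"
    using linear_bounded[of "\<lambda>v. P *v (A *v v)"] 
    by (metis linear_bounded_pos matrix_vector_mul_assoc matrix_vector_mul_linear less_imp_le)
  show ?thesis
  proof (rule bdd_aboveI)
    fix x assume "x \<in> {semi_norm N P (A *v v) / semi_norm N P v | v. v \<in> (semi_ker N P)\<^sup>\<bottom> - {0}}"
    then obtain v where v: "v \<in> (semi_ker N P)\<^sup>\<bottom>" "v \<noteq> 0" and x: "x = semi_norm N P (A *v v) / semi_norm N P v"
      by auto
    have "semi_norm N P (A *v v) \<le> C * (K * norm v)"
      unfolding semi_norm_def using order_trans[OF C(2) mult_left_mono[OF K(2)]] C(1) by simp
    moreover have "c * (e * norm v) \<le> semi_norm N P v"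
      unfolding semi_norm_def using order_trans[OF mult_left_mono[OF e(2)] c(2)] c(1) v by simp
    moreover have "0 < c * (e * norm v)"
      using c e v by simp
    ultimately have "semi_norm N P (A *v v) / semi_norm N P v \<le> C * (K * norm v) / (c * (e * norm v))"
      using C K by (intro frac_le) auto
    also have "\<dots> = C * K / (c * e)"
      using v by simp
    finally show "x \<le> C * K / (c * e)"
      unfolding x .
  qed
qed

lemma induced_semi_norm_bound:
  assumes "v \<in> (semi_ker N P)\<^sup>\<bottom>"
  shows "semi_norm N P (A *v v) \<le> induced_semi_norm N P A * semi_norm N P v"
proof (cases "v = 0")
  case True
  then show ?thesis by (simp add: semi_norm_def is_norm_0[OF norm_N])
next
  case False
  then have "semi_norm N P (A *v v) / semi_norm N P v \<le> induced_semi_norm N P A"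
    unfolding induced_semi_norm_def using assms
    by (intro cSup_upper bdd_above_semi_norm_ratios) auto
  then show ?thesis
    using semi_norm_pos_on_complement[OF assms False] by (simp add: field_simps)
qed

lemma induced_semi_norm_le:
  assumes "z \<in> (semi_ker N P)\<^sup>\<bottom>" "z \<noteq> 0"
    and "\<And>v. v \<in> (semi_ker N P)\<^sup>\<bottom> \<Longrightarrow> semi_norm N P (A *v v) \<le> B * semi_norm N P v"
  shows "induced_semi_norm N P A \<le> B"
  unfolding induced_semi_norm_def
proof (rule cSup_least)
  show "{semi_norm N P (A *v v) / semi_norm N P v | v. v \<in> (semi_ker N P)\<^sup>\<bottom> - {0}} \<noteq> {}"
    using assms by auto
  fix x assume "x \<in> {semi_norm N P (A *v v) / semi_norm N P v | v. v \<in> (semi_ker N P)\<^sup>\<bottom> - {0}}"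
  then obtain v where v: "v \<in> (semi_ker N P)\<^sup>\<bottom>" "v \<noteq> 0" "x = semi_norm N P (A *v v) / semi_norm N P v"
    by auto
  then show "x \<le> B"
    using assms(3)[of v] semi_norm_pos_on_complement[of v] by (simp add: pos_divide_le_eq)
qed

text \<open>
As a supremum of functions convex in \<open>h\<close>, the induced semi-norm of \<open>I + h A\<close> is convex in
\<open>h\<close>. The vector \<open>z\<close> witnesses that the supremum ranges over a nonempty set; it makes the
induced semi-norm of the identity equal to \<open>1\<close> and bounds the difference quotients from below.
\<close>

lemma log_semi_norm_tendsto:
  assumes z: "z \<in> (semi_ker N P)\<^sup>\<bottom>" "z \<noteq> 0"
  shows "((\<lambda>h. (induced_semi_norm N P (mat 1 + h *\<^sub>R A) - 1) / h) \<longlongrightarrow> log_semi_norm N P A) (at_right 0)"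
proof -
  let ?M = "\<lambda>h. mat 1 + h *\<^sub>R A"
  let ?c = "\<lambda>h. induced_semi_norm N P (?M h)"
  have M_apply: "P *v (?M h *v v) = P *v v + h *\<^sub>R (P *v (A *v v))" for h v
    by (simp add: matrix_vector_mult_add_rdistrib matrix_vector_right_distrib
        scaleR_matrix_vector_assoc[symmetric] matrix_vector_mult_scaleR)
  have convex: "convex_on {0..} ?c"
  proof (rule convex_onI)
    fix t h k :: real assume t: "0 < t" "t < 1"
    show "?c ((1 - t) *\<^sub>R h + t *\<^sub>R k) \<le> (1 - t) * ?c h + t * ?c k"
    proof (rule induced_semi_norm_le[OF z])
      fix v assume v: "v \<in> (semi_ker N P)\<^sup>\<bottom>"
      have "semi_norm N P (?M ((1 - t) *\<^sub>R h + t *\<^sub>R k) *v v) \<le> (1 - t) * semi_norm N P (?M h *v v) + t * semi_norm N P (?M k *v v)"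
        using convex_onD[OF convex_on_is_norm_ray[OF norm_N convex_UNIV, of "P *v v" "P *v (A *v v)"],
            of t h k] t
        unfolding semi_norm_def M_apply by simp
      also have "\<dots> \<le> (1 - t) * (?c h * semi_norm N P v) + t * (?c k * semi_norm N P v)"
        using t by (intro add_mono mult_left_mono induced_semi_norm_bound v) auto
      finally show "semi_norm N P (?M ((1 - t) *\<^sub>R h + t *\<^sub>R k) *v v) \<le> ((1 - t) * ?c h + t * ?c k) * semi_norm N P v"
        by (simp add: algebra_simps)
    qed
  qed auto
  have "0 < semi_norm N P z"
    using semi_norm_pos_on_complement[OF z] .
  have c0: "?c 0 = 1"
  proof (rule antisym)
    show "?c 0 \<le> 1"
      by (rule induced_semi_norm_le[OF z]) simp
    show "1 \<le> ?c 0"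
      using induced_semi_norm_bound[OF z(1), of "mat 1"] \<open>0 < semi_norm N P z\<close> by simp
  qed
  have "- (semi_norm N P (A *v z) / semi_norm N P z) \<le> (?c h - ?c 0) / h" if "0 < h" for h
  proof -
    have "semi_norm N P z - h * semi_norm N P (A *v z) \<le> semi_norm N P (?M h *v z)"
      using is_norm_diff[OF norm_N, of "P *v z + h *\<^sub>R (P *v (A *v z))" "P *v z"] that
      unfolding semi_norm_def M_apply by (simp add: is_norm_scaleR[OF norm_N])
    also have "\<dots> \<le> ?c h * semi_norm N P z"
      by (rule induced_semi_norm_bound[OF z(1)])
    finally show ?thesis
      using that \<open>0 < semi_norm N P z\<close> unfolding c0 by (simp add: field_simps)
  qed
  then obtain L where "((\<lambda>h. (?c h - ?c 0) / h) \<longlongrightarrow> L) (at_right 0)"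
    by (rule convex_difference_quotient_tendsto[OF convex])
  then show ?thesis
    unfolding log_semi_norm_def c0 by (simp add: tendsto_Lim)
qed

lemma norm_derivative_le_log_semi_norm:
  assumes z: "z \<in> (semi_ker N P)\<^sup>\<bottom>"
  shows "norm_derivative N (P *v z) (P *v (A *v z)) \<le> log_semi_norm N P A * semi_norm N P z"
proof (cases "z = 0")
  case True
  then show ?thesis by (simp add: norm_derivative_0[OF norm_N] semi_norm_def is_norm_0[OF norm_N])
next
  case False
  show ?thesis
  proof (rule tendsto_le)
    show "((\<lambda>h. (induced_semi_norm N P (mat 1 + h *\<^sub>R A) - 1) / h * semi_norm N P z)
        \<longlongrightarrow> log_semi_norm N P A * semi_norm N P z) (at_right 0)"
      by (intro tendsto_intros log_semi_norm_tendsto[OF z False])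
    show "((\<lambda>h. (N (P *v z + h *\<^sub>R (P *v (A *v z))) - N (P *v z)) / h)
        \<longlongrightarrow> norm_derivative N (P *v z) (P *v (A *v z))) (at_right 0)"
      by (rule norm_derivative_tendsto[OF norm_N])
    have "(N (P *v z + h *\<^sub>R (P *v (A *v z))) - N (P *v z)) / h
        \<le> (induced_semi_norm N P (mat 1 + h *\<^sub>R A) - 1) / h * semi_norm N P z" if "0 < h" for h
    proof -
      have "P *v z + h *\<^sub>R (P *v (A *v z)) = P *v ((mat 1 + h *\<^sub>R A) *v z)"
        by (simp add: matrix_vector_mult_add_rdistrib matrix_vector_right_distrib
            scaleR_matrix_vector_assoc[symmetric] matrix_vector_mult_scaleR)
      then have "N (P *v z + h *\<^sub>R (P *v (A *v z))) \<le> induced_semi_norm N P (mat 1 + h *\<^sub>R A) * semi_norm N P z"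
        using induced_semi_norm_bound[OF z, of "mat 1 + h *\<^sub>R A"] by (simp add: semi_norm_def)
      then have "N (P *v z + h *\<^sub>R (P *v (A *v z))) - N (P *v z)
          \<le> (induced_semi_norm N P (mat 1 + h *\<^sub>R A) - 1) * semi_norm N P z"
        by (simp add: semi_norm_def algebra_simps)
      from divide_right_mono[OF this, of h] that show ?thesis by simp
    qed
    then show "eventually (\<lambda>h. (N (P *v z + h *\<^sub>R (P *v (A *v z))) - N (P *v z)) / h
        \<le> (induced_semi_norm N P (mat 1 + h *\<^sub>R A) - 1) / h * semi_norm N P z) (at_right 0)"
      by (intro eventually_at_rightI[of 0 1]) auto
  qed simp
qed

end

section \<open>Contraction towards a fibre of the semi-norm\<close>

text \<open>
At almost every time the curve formula gives a product of the norm and its derivative that is not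
positive. Dividing by the norm fails where \<open>u\<close> vanishes, and the formula says nothing there;
the last hypothesis makes the derivative of the norm vanish at those times. The norm is Lipschitz
along the curve, so a sign of its derivative almost everywhere suffices.
\<close>

lemma norm_curve_nonincreasing:
  fixes u :: "real \<Rightarrow> 'a::euclidean_space"
  assumes N: "is_norm N" and curve: "curve_norm_derivative_formula N V p"
    and "s \<le> t"
    and u: "\<And>r. r \<in> {s..t} \<Longrightarrow> (u has_vector_derivative u' r) (at r within {s..t})"
    and u'_cont: "continuous_on {s..t} u'"
    and V: "\<And>r. r \<in> {s..t} \<Longrightarrow> u r \<in> V"
    and p_le: "\<And>r. r \<in> {s..t} \<Longrightarrow> p (u' r) (u r) \<le> 0"
    and rest: "\<And>r. r \<in> {s..t} \<Longrightarrow> u r = 0 \<Longrightarrow> u' r = 0"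
  shows "N (u t) \<le> N (u s)"
proof -
  have deriv_at: "(u has_vector_derivative u' r) (at r)" if "r \<in> {s<..<t}" for r
  proof -
    have "(u has_vector_derivative u' r) (at r within {s<..<t})"
      using that by (intro has_vector_derivative_within_subset[OF u]) auto
    then show ?thesis
      using has_vector_derivative_within_open[OF that open_greaterThanLessThan] by blast
  qed
  have dini_nonpos: "upper_right_dini (\<lambda>r. N (u r)) r \<le> 0"
    if r: "r \<in> {s<..<t}" and
      formula: "ereal (N (u r)) * upper_right_dini (\<lambda>s. N (u s)) r
        = ereal (p (vector_derivative u (at r)) (u r))" for r
  proof -
    let ?d = "norm_derivative N (u r) (u' r)"
    have deriv: "(u has_vector_derivative u' r) (at r within {s..t})"
      using r u[of r] by simp
    have dini: "upper_right_dini (\<lambda>r. N (u r)) r = ereal ?d"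
      by (rule upper_right_dini_norm_curve[OF N deriv, of t]) (use r in auto)
    have "N (u r) * ?d = p (u' r) (u r)"
      using formula by (simp add: dini vector_derivative_at[OF deriv_at[OF r]])
    then have prod: "N (u r) * ?d \<le> 0"
      using p_le[of r] r by simp
    have "?d \<le> 0"
    proof (cases "u r = 0")
      case True
      then show ?thesis
        using rest[of r] r by (simp add: norm_derivative_0[OF N])
    next
      case False
      then have "0 < N (u r)"
        using is_norm_nonneg[OF N, of "u r"] is_norm_eq_0_iff[OF N, of "u r"] by simp
      with prod show ?thesis
        by (simp add: mult_le_0_iff)
    qed
    then show ?thesis by (simp add: dini)
  qed
  obtain C where C: "0 < C" "\<And>x y. \<bar>N x - N y\<bar> \<le> C * norm (x - y)"
    using is_norm_lipschitz[OF N] by blast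
  have "bounded (u' ` {s..t})"
    by (intro compact_imp_bounded compact_continuous_image u'_cont) auto
  then obtain B where B: "0 < B" "\<And>r. r \<in> {s..t} \<Longrightarrow> norm (u' r) \<le> B"
    unfolding bounded_pos by auto
  have "B-lipschitz_on {s..t} u"
    using B by (intro lipschitz_on_if_vector_derivative_bounded[OF _ _ u]) auto
  moreover have "C-lipschitz_on UNIV N"
    using C by (intro lipschitz_onI) (auto simp: dist_norm)
  ultimately have "(C * B)-lipschitz_on {s..t} (\<lambda>r. N (u r))"
    by (rule lipschitz_on_compose2[OF _ lipschitz_on_subset[OF _ subset_UNIV]])
  moreover have "AE r in lebesgue. r \<in> {s<..<t} \<longrightarrow>
      ereal (N (u r)) * upper_right_dini (\<lambda>s. N (u s)) r
        = ereal (p (vector_derivative u (at r)) (u r))"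
    using differentiableI_vector[OF deriv_at] V
    by (intro curve[unfolded curve_norm_derivative_formula_def, rule_format]) auto
  then have "AE r in lebesgue. r \<in> {s<..<t} \<longrightarrow> upper_right_dini (\<lambda>r. N (u r)) r \<le> 0"
    by eventually_elim (use dini_nonpos in blast)
  ultimately show ?thesis
    by (intro lipschitz_nonincreasing_if_AE_dini_nonpos[OF \<open>s \<le> t\<close>])
qed

text \<open>
A weak pairing is only subadditive in its first argument, which for \<open>c < 0\<close> bounds the left side
from below. The upper bound comes from Deimling's inequality, since the derivative of the norm at
\<open>w\<close> in direction \<open>- w\<close> is \<open>- N w\<close>.
\<close>

lemma weak_pairing_deimling_scaled_self:
  fixes V :: "'a::euclidean_space set"
  assumes N: "is_norm N" and p: "weak_pairing V p" and comp: "compatible_pairing N V p"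
    and deimling: "deimling_inequality N V p" and w: "w \<in> V"
  shows "p (c *\<^sub>R w) w \<le> c * (N w)\<^sup>2"
proof -
  have hom: "p (a *\<^sub>R x) w = a * p x w" if "0 \<le> a" "x \<in> V" for a x
    using p w that unfolding weak_pairing_def by blast
  have "- w \<in> V"
    using p w unfolding weak_pairing_def by (blast intro: subspace_neg)
  have "p (- w) w \<le> N w * norm_derivative N w (- w)"
    using deimling w \<open>- w \<in> V\<close> unfolding deimling_inequality_def norm_derivative_def by blast
  then have neg: "p (- w) w \<le> - (N w)\<^sup>2"
    by (simp add: norm_derivative_minus_self[OF N] power2_eq_square)
  show ?thesis
  proof (cases "0 \<le> c")
    case True
    then show ?thesis
      using hom[OF True w] comp w by (simp add: compatible_pairing_def)
  next
    case False
    then have "p (c *\<^sub>R w) w = (- c) * p (- w) w"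
      using hom[of "- c" "- w"] \<open>- w \<in> V\<close> by simp
    also have "\<dots> \<le> (- c) * (- (N w)\<^sup>2)"
      using False neg by (intro mult_left_mono) auto
    finally show ?thesis by simp
  qed
qed

locale semi_contraction_setting =
  fixes f :: "real \<Rightarrow> real^'n \<Rightarrow> real^'n"
    and P :: "real^'n^'k"
    and N :: "real^'k \<Rightarrow> real"
    and p :: "real^'k \<Rightarrow> real^'k \<Rightarrow> real"
    and xs :: "real^'n"
    and b :: real
  assumes f_cont: "continuous_on ({0..} \<times> UNIV) (\<lambda>(t, x). f t x)"
    and norm_N: "is_norm N"
    and pairing: "weak_pairing (range ((*v) P)) p"
    and compatible: "compatible_pairing N (range ((*v) P)) p"
    and deimling: "deimling_inequality N (range ((*v) P)) p"
    and curve: "curve_norm_derivative_formula N (range ((*v) P)) p"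
    and ker_invariant: "\<forall>t\<ge>0. f t ` {xs + v | v. v \<in> semi_ker N P} \<subseteq> semi_ker N P"
begin

abbreviation V :: "(real^'k) set" where "V \<equiv> range ((*v) P)"

definition pairing_bound :: bool where
  "pairing_bound \<longleftrightarrow> (\<forall>x. \<forall>t\<ge>0. p (P *v f t x) (P *v (x - xs)) \<le> b * (semi_norm N P (x - xs))\<^sup>2)"

definition dini_bound :: bool where
  "dini_bound \<longleftrightarrow>
    (\<forall>J t0 x0 \<phi> t. ode_solution f J t0 x0 \<phi> \<and> 0 \<le> t0 \<and> t0 \<le> t \<and> t \<in> J \<and> (\<exists>u\<in>J. t < u) \<longrightarrow>
       upper_right_dini (\<lambda>r. semi_norm N P (\<phi> r - xs)) t
         \<le> ereal (b * semi_norm N P (\<phi> t - xs)))"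

definition exponential_bound :: bool where
  "exponential_bound \<longleftrightarrow>
    (\<forall>J t0 x0 \<phi> s t. ode_solution f J t0 x0 \<phi> \<and> 0 \<le> t0 \<and> t0 \<le> s \<and> s \<le> t \<and> s \<in> J \<and> t \<in> J \<longrightarrow>
       semi_norm N P (\<phi> t - xs) \<le> exp (b * (t - s)) * semi_norm N P (\<phi> s - xs))"

lemma deimling_derivative: "x \<in> V \<Longrightarrow> y \<in> V \<Longrightarrow> p x y \<le> N y * norm_derivative N y x"
  using deimling unfolding deimling_inequality_def norm_derivative_def by blast

text \<open>
This is the invariance of the kernel, read through \<open>P\<close>: a point with the same image as \<open>xs\<close>
lies on the fibre \<open>xs + semi_ker N P\<close>.
\<close>

lemma field_vanishes_on_fibre:
  assumes "0 \<le> t" "P *v (x - xs) = 0"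
  shows "P *v f t x = 0"
proof -
  have "x = xs + (x - xs)" "x - xs \<in> semi_ker N P"
    using assms by (auto simp: semi_ker_eq[OF norm_N])
  then have "f t x \<in> semi_ker N P"
    using ker_invariant assms(1) by blast
  then show ?thesis
    by (simp add: semi_ker_eq[OF norm_N])
qed

text \<open>
The claim says that the norm of the rescaled curve \<open>exp (- b r) P (\<phi> r - xs)\<close> decreases. Scaling
the curve rather than its norm lets the curve formula apply directly: the extra term
\<open>- b w\<close> in the derivative contributes \<open>- b (N w)\<^sup>2\<close> to the pairing and cancels the bound.
\<close>

lemma pairing_bound_imp_exponential_bound:
  assumes pairing_bound
  shows exponential_bound
  unfolding exponential_bound_def
proof (intro allI impI, elim conjE)
  fix J t0 x0 \<phi> s t
  assume sol: "ode_solution f J t0 x0 \<phi>" and "s \<le> t" "s \<in> J" "t \<in> J"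
  let ?w = "\<lambda>r. P *v (\<phi> r - xs)"
  define u where "u r = exp (- (b * r)) *\<^sub>R ?w r" for r
  define u' where "u' r = exp (- (b * r)) *\<^sub>R (P *v f r (\<phi> r) + (- b) *\<^sub>R ?w r)" for r
  have "is_interval J" and J0: "J \<subseteq> {0..}"
    using sol by (auto simp: ode_solution_def)
  then have sub: "{s..t} \<subseteq> J"
    using \<open>s \<in> J\<close> \<open>t \<in> J\<close> mem_is_interval_1_I[of J s t] by auto
  have \<phi>: "(\<phi> has_vector_derivative f r (\<phi> r)) (at r within {s..t})" if "r \<in> {s..t}" for r
    using sol sub that unfolding ode_solution_def
    by (blast intro: has_vector_derivative_within_subset)
  then have \<phi>_cont: "continuous_on {s..t} \<phi>"
    by (rule continuous_on_vector_derivative)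
  have nonneg: "0 \<le> r" if "r \<in> {s..t}" for r
    using that sub J0 by auto
  have mul_cont: "continuous_on S ((*v) P)" for S
    by (intro linear_continuous_on matrix_vector_mul_bounded_linear)
  have "continuous_on {s..t} (\<lambda>r. f r (\<phi> r))"
    using continuous_on_compose2[OF f_cont, of "{s..t}" "\<lambda>r. (r, \<phi> r)"] \<phi>_cont nonneg
    by (force intro!: continuous_intros)
  then have u'_cont: "continuous_on {s..t} u'"
    unfolding u'_def
    by (intro continuous_intros \<phi>_cont continuous_on_compose2[OF mul_cont[of UNIV]]) auto
  have u_deriv: "(u has_vector_derivative u' r) (at r within {s..t})" if r: "r \<in> {s..t}" for r
  proof -
    have w: "(?w has_vector_derivative P *v f r (\<phi> r)) (at r within {s..t})"
      using bounded_linear.has_vector_derivative[OF matrix_vector_mul_bounded_linear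
          has_vector_derivative_diff[OF \<phi>[OF r] has_vector_derivative_const], of P xs] by simp
    have e: "((\<lambda>r. exp (- (b * r))) has_field_derivative exp (- (b * r)) * (- b)) (at r within {s..t})"
      by (auto intro!: derivative_eq_intros)
    from has_vector_derivative_scaleR[OF e w] show ?thesis
      unfolding u_def u'_def by (simp add: scaleR_diff_right)
  qed
  have "N (u t) \<le> N (u s)"
  proof (rule norm_curve_nonincreasing[OF norm_N curve \<open>s \<le> t\<close> u_deriv u'_cont])
    fix r assume r: "r \<in> {s..t}"
    have u_eq: "u r = P *v (exp (- (b * r)) *\<^sub>R (\<phi> r - xs))"
      by (simp add: u_def matrix_vector_mult_scaleR)
    then show "u r \<in> V" by blast
    have V: "?w r \<in> V" "P *v f r (\<phi> r) \<in> V" "(- b) *\<^sub>R ?w r \<in> V"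
      "P *v f r (\<phi> r) + (- b) *\<^sub>R ?w r \<in> V"
      by (auto simp: matrix_vector_mult_scaleR[symmetric] matrix_vector_right_distrib[symmetric]
          simp del: scaleR_minus_left)
    have "p (P *v f r (\<phi> r) + (- b) *\<^sub>R ?w r) (?w r)
        \<le> p (P *v f r (\<phi> r)) (?w r) + p ((- b) *\<^sub>R ?w r) (?w r)"
      using pairing V unfolding weak_pairing_def by blast
    also have "\<dots> \<le> b * (N (?w r))\<^sup>2 + (- b) * (N (?w r))\<^sup>2"
      using assms nonneg[OF r] unfolding pairing_bound_def semi_norm_def
      by (intro add_mono weak_pairing_deimling_scaled_self[OF norm_N pairing compatible deimling V(1)])
        auto
    finally have "p (P *v f r (\<phi> r) + (- b) *\<^sub>R ?w r) (?w r) \<le> 0"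
      by simp
    moreover have "p (a *\<^sub>R x) (a *\<^sub>R y) = a * (a * p x y)" if "0 \<le> a" "x \<in> V" "y \<in> V" for a x y
    proof -
      have "a *\<^sub>R y \<in> V"
        using pairing that unfolding weak_pairing_def by (blast intro: subspace_scale)
      with pairing that show ?thesis
        unfolding weak_pairing_def by metis
    qed
    ultimately show "p (u' r) (u r) \<le> 0"
      unfolding u_def u'_def using V by (simp add: mult_le_0_iff del: scaleR_minus_left)
    show "u' r = 0" if "u r = 0"
      using that field_vanishes_on_fibre[OF nonneg[OF r]] by (simp add: u_def u'_def)
  qed
  then have "exp (- (b * t)) * N (?w t) \<le> exp (- (b * s)) * N (?w s)"
    by (simp add: u_def is_norm_scaleR[OF norm_N])
  then have "exp (b * t) * (exp (- (b * t)) * N (?w t)) \<le> exp (b * t) * (exp (- (b * s)) * N (?w s))"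
    by (rule mult_left_mono) simp
  then show "semi_norm N P (\<phi> t - xs) \<le> exp (b * (t - s)) * semi_norm N P (\<phi> s - xs)"
    by (simp add: semi_norm_def mult.assoc[symmetric] exp_add[symmetric] algebra_simps)
qed

text \<open>
The exponential bound on \<open>[t, t + h]\<close> majorises the difference quotient by
\<open>(exp (b h) - 1) / h\<close> times the semi-norm at \<open>t\<close>, and this factor tends to \<open>b\<close>.
\<close>

lemma exponential_bound_imp_dini_bound:
  assumes exponential_bound
  shows dini_bound
  unfolding dini_bound_def
proof (intro allI impI, elim conjE bexE)
  fix J t0 x0 \<phi> t u
  assume sol: "ode_solution f J t0 x0 \<phi>" and t: "0 \<le> t0" "t0 \<le> t" "t \<in> J" "u \<in> J" "t < u"
  let ?g = "\<lambda>r. semi_norm N P (\<phi> r - xs)"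
  have interval: "{t..u} \<subseteq> J"
    using sol t mem_is_interval_1_I[of J t u] by (auto simp: ode_solution_def)
  have "((\<lambda>h. ereal ((exp (b * h) - 1) / h * ?g t)) \<longlongrightarrow> ereal (b * ?g t)) (at_right 0)"
  proof -
    have "((\<lambda>h. exp (b * h)) has_real_derivative b) (at 0)"
      by (auto intro!: derivative_eq_intros)
    then have "((\<lambda>h. (exp (b * h) - 1) / h) \<longlongrightarrow> b) (at_right 0)"
      by (auto simp: has_field_derivative_iff intro: tendsto_mono[OF at_le])
    then show ?thesis
      by (intro tendsto_intros)
  qed
  then have "Limsup (at_right 0) (\<lambda>h. ereal ((exp (b * h) - 1) / h * ?g t)) = ereal (b * ?g t)"
    by (intro lim_imp_Limsup) simp
  moreover have "upper_right_dini ?g t \<le> Limsup (at_right 0) (\<lambda>h. ereal ((exp (b * h) - 1) / h * ?g t))"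
    unfolding upper_right_dini_def
  proof (rule Limsup_mono, rule eventually_at_rightI[of 0 "u - t"])
    fix h assume h: "h \<in> {0<..<u - t}"
    then have "t + h \<in> J"
      using interval by auto
    with h have "?g (t + h) \<le> exp (b * (t + h - t)) * ?g t"
      using assms[unfolded exponential_bound_def, rule_format, of J t0 x0 \<phi> t "t + h"] sol t by simp
    then have "(?g (t + h) - ?g t) / h \<le> ((exp (b * h) - 1) * ?g t) / h"
      using h by (intro divide_right_mono) (auto simp: algebra_simps)
    then show "ereal ((?g (t + h) - ?g t) / h) \<le> ereal ((exp (b * h) - 1) / h * ?g t)"
      by simp
  qed (use t in auto)
  ultimately show "upper_right_dini ?g t \<le> ereal (b * ?g t)"
    by simp
qed

text \<open>
The Dini bound speaks of solutions only, so a solution must pass through the given point; Peano's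
theorem provides it. At its initial time the Dini derivative equals the derivative of the norm in
direction \<open>P f\<close>, which Deimling's inequality compares with the pairing.
\<close>

lemma dini_bound_imp_pairing_bound:
  assumes dini_bound
  shows pairing_bound
  unfolding pairing_bound_def
proof (intro allI impI)
  fix x and t :: real assume "0 \<le> t"
  let ?w = "P *v (x - xs)"
  have "continuous_on ({t..t + 1} \<times> UNIV) (\<lambda>(t, x). f t x)"
    using \<open>0 \<le> t\<close> by (intro continuous_on_subset[OF f_cont]) auto
  then obtain d \<phi> where d: "0 < d" and \<phi>0: "\<phi> t = x"
    and \<phi>: "\<And>r. r \<in> {t..t + d} \<Longrightarrow> (\<phi> has_vector_derivative f r (\<phi> r)) (at r within {t..t + d})"
    using peano_existence[of t f x] by blast
  have "ode_solution f {t..t + d} t x \<phi>"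
    using \<open>0 \<le> t\<close> d \<phi>0 \<phi> by (auto simp: ode_solution_def is_interval_cc)
  moreover have "t \<in> {t..t + d}" "\<exists>u\<in>{t..t + d}. t < u"
    using d by (auto intro: bexI[of _ "t + d"])
  ultimately have "upper_right_dini (\<lambda>r. semi_norm N P (\<phi> r - xs)) t \<le> ereal (b * semi_norm N P (\<phi> t - xs))"
    using assms[unfolded dini_bound_def, rule_format, of "{t..t + d}" t x \<phi> t] \<open>0 \<le> t\<close> by simp
  moreover have "((\<lambda>r. P *v (\<phi> r - xs)) has_vector_derivative P *v f t x) (at t within {t..t + d})"
    using bounded_linear.has_vector_derivative[OF matrix_vector_mul_bounded_linear
        has_vector_derivative_diff[OF \<phi> has_vector_derivative_const], of t P xs] d \<phi>0 by simp
  then have "upper_right_dini (\<lambda>r. N (P *v (\<phi> r - xs))) t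
      = ereal (norm_derivative N (P *v (\<phi> t - xs)) (P *v f t x))"
    using d by (intro upper_right_dini_norm_curve[OF norm_N, of _ _ t "{t..t + d}" "t + d"]) auto
  ultimately have le: "norm_derivative N ?w (P *v f t x) \<le> b * N ?w"
    by (simp add: semi_norm_def \<phi>0)
  have "p (P *v f t x) ?w \<le> N ?w * norm_derivative N ?w (P *v f t x)"
    by (intro deimling_derivative) auto
  also have "\<dots> \<le> N ?w * (b * N ?w)"
    by (intro mult_left_mono le is_norm_nonneg[OF norm_N])
  finally show "p (P *v f t x) ?w \<le> b * (semi_norm N P (x - xs))\<^sup>2"
    by (simp add: semi_norm_def power2_eq_square mult_ac)
qed

text \<open>
Write \<open>x = xs + y + z\<close> with \<open>y\<close> in the kernel and \<open>z\<close> orthogonal to it. The projected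
field vanishes at \<open>xs + y\<close>, so at \<open>x\<close> it is the increment along the segment in direction
\<open>z\<close>. The derivative along the segment is \<open>P J z\<close> with \<open>J\<close> a Jacobian, and the log
semi-norm of \<open>J\<close> controls the derivative of the norm at \<open>P z\<close> in this direction because
\<open>z\<close> is orthogonal to the kernel.
\<close>

lemma log_semi_norm_imp_pairing_bound:
  assumes diff: "\<And>t x. 0 \<le> t \<Longrightarrow> f t differentiable (at x)"
    and log_le: "\<And>t x. 0 \<le> t \<Longrightarrow> log_semi_norm N P (jacobian (f t) (at x)) \<le> b"
  shows pairing_bound
  unfolding pairing_bound_def
proof (intro allI impI)
  fix x and t :: real assume "0 \<le> t"
  obtain y z where y: "y \<in> span (semi_ker N P)"
    and orth: "\<And>v. v \<in> span (semi_ker N P) \<Longrightarrow> orthogonal z v" and x: "x - xs = y + z"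
    using orthogonal_subspace_decomp_exists[of "semi_ker N P" "x - xs"] by metis
  have z: "z \<in> (semi_ker N P)\<^sup>\<bottom>"
    using orth span_base by (auto simp: orthogonal_comp_def orthogonal_commute)
  have "y \<in> semi_ker N P"
    using y span_eq_iff subspace_semi_ker[OF norm_N] by blast
  then have Py: "P *v y = 0"
    by (simp add: semi_ker_eq[OF norm_N])
  then have w: "P *v (x - xs) = P *v z"
    by (simp add: x matrix_vector_right_distrib)
  let ?J = "\<lambda>r. jacobian (f t) (at (xs + y + r *\<^sub>R z))"
  have "norm_derivative N (P *v z) (P *v f t (xs + y + 1 *\<^sub>R z) - P *v f t (xs + y + 0 *\<^sub>R z))
      \<le> b * semi_norm N P z"
  proof (rule norm_derivative_mean_value[OF norm_N])
    fix r :: real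
    have "((\<lambda>r. xs + y + r *\<^sub>R z) has_vector_derivative z) (at r within {0..1})"
      by (auto intro!: derivative_eq_intros)
    moreover have "(f t has_derivative (*v) (?J r)) (at (xs + y + r *\<^sub>R z))"
      using diff[OF \<open>0 \<le> t\<close>] by (simp add: jacobian_works)
    ultimately have "((\<lambda>r. f t (xs + y + r *\<^sub>R z)) has_vector_derivative ?J r *v z) (at r within {0..1})"
      unfolding has_vector_derivative_def
      by (auto dest: has_derivative_compose simp: matrix_vector_mult_scaleR)
    then show "((\<lambda>r. P *v f t (xs + y + r *\<^sub>R z)) has_vector_derivative P *v (?J r *v z))
        (at r within {0..1})"
      by (rule bounded_linear.has_vector_derivative[OF matrix_vector_mul_bounded_linear])
    have "norm_derivative N (P *v z) (P *v (?J r *v z)) \<le> log_semi_norm N P (?J r) * semi_norm N P z"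
      by (rule norm_derivative_le_log_semi_norm[OF norm_N z])
    also have "\<dots> \<le> b * semi_norm N P z"
      using is_norm_nonneg[OF norm_N]
      by (intro mult_right_mono log_le[OF \<open>0 \<le> t\<close>]) (simp add: semi_norm_def)
    finally show "norm_derivative N (P *v z) (P *v (?J r *v z)) \<le> b * semi_norm N P z" .
  qed
  moreover have "P *v f t (xs + y) = 0"
    using field_vanishes_on_fibre[OF \<open>0 \<le> t\<close>, of "xs + y"] Py by simp
  moreover have "xs + y + z = x"
    using x by (simp add: algebra_simps)
  ultimately have le: "norm_derivative N (P *v z) (P *v f t x) \<le> b * N (P *v z)"
    by (simp add: semi_norm_def)
  have "p (P *v f t x) (P *v z) \<le> N (P *v z) * norm_derivative N (P *v z) (P *v f t x)"
    by (intro deimling_derivative) auto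
  also have "\<dots> \<le> N (P *v z) * (b * N (P *v z))"
    by (intro mult_left_mono le is_norm_nonneg[OF norm_N])
  finally show "p (P *v f t x) (P *v (x - xs)) \<le> b * (semi_norm N P (x - xs))\<^sup>2"
    by (simp add: semi_norm_def w power2_eq_square mult_ac)
qed

end

theorem theorem61:
  fixes f :: "real \<Rightarrow> real^'n \<Rightarrow> real^'n"
    and P :: "real^'n^'k"
    and N :: "real^'k \<Rightarrow> real"
    and p :: "real^'k \<Rightarrow> real^'k \<Rightarrow> real"
    and xs :: "real^'n"
    and b :: real
  assumes f_cont: "continuous_on ({0..} \<times> UNIV) (\<lambda>(t, x). f t x)"
    and norm_N: "is_norm N"
    and matrix_P: "admissible_matrix P"
    and pairing: "weak_pairing (range ((*v) P)) p"
    and compatible: "compatible_pairing N (range ((*v) P)) p"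
    and deimling: "deimling_inequality N (range ((*v) P)) p"
    and curve: "curve_norm_derivative_formula N (range ((*v) P)) p"
    and xs_perp: "xs \<in> (semi_ker N P)\<^sup>\<bottom>"
    and ker_invariant: "\<forall>t\<ge>0. f t ` {xs + v | v. v \<in> semi_ker N P} \<subseteq> semi_ker N P"
  shows
    "let
       statement_i =
         (\<forall>x. \<forall>t\<ge>0. p (P *v f t x) (P *v (x - xs)) \<le> b * (semi_norm N P (x - xs))\<^sup>2);
       statement_ii =
         (\<forall>J t0 x0 \<phi> t. ode_solution f J t0 x0 \<phi> \<and> 0 \<le> t0 \<and> t0 \<le> t \<and> t \<in> J \<and> (\<exists>u\<in>J. t < u) \<longrightarrow>
            upper_right_dini (\<lambda>r. semi_norm N P (\<phi> r - xs)) t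
              \<le> ereal (b * semi_norm N P (\<phi> t - xs)));
       statement_iii =
         (\<forall>J t0 x0 \<phi> s t. ode_solution f J t0 x0 \<phi> \<and> 0 \<le> t0 \<and> t0 \<le> s \<and> s \<le> t \<and> s \<in> J \<and> t \<in> J \<longrightarrow>
            semi_norm N P (\<phi> t - xs) \<le> exp (b * (t - s)) * semi_norm N P (\<phi> s - xs))
     in
       (statement_i \<longleftrightarrow> statement_ii) \<and> (statement_ii \<longleftrightarrow> statement_iii) \<and>
       ((\<forall>t\<ge>0. (\<forall>x. f t differentiable (at x)) \<and>
                continuous_on UNIV (\<lambda>x. jacobian (f t) (at x))) \<and>
        (\<forall>t\<ge>0. \<forall>x. log_semi_norm N P (jacobian (f t) (at x)) \<le> b) \<longrightarrow>
          statement_i \<and> statement_ii \<and> statement_iii)"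
proof -
  interpret semi_contraction_setting f P N p xs b
    by unfold_locales fact+
  have "pairing_bound \<longleftrightarrow> dini_bound" "dini_bound \<longleftrightarrow> exponential_bound"
    using pairing_bound_imp_exponential_bound exponential_bound_imp_dini_bound
      dini_bound_imp_pairing_bound by argo+
  moreover have "pairing_bound"
    if "(\<forall>t\<ge>0. (\<forall>x. f t differentiable (at x)) \<and>
                continuous_on UNIV (\<lambda>x. jacobian (f t) (at x))) \<and>
        (\<forall>t\<ge>0. \<forall>x. log_semi_norm N P (jacobian (f t) (at x)) \<le> b)"
    using that by (intro log_semi_norm_imp_pairing_bound) auto
  ultimately show ?thesis
    unfolding Let_def pairing_bound_def[symmetric] dini_bound_def[symmetric]
      exponential_bound_def[symmetric] by blast
qed

end
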